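(* Consider the problem of minimizing $f(X)=\mathbb{E}_{\zeta\sim D}[g(X,\zeta)]$ over $X\in\mathrm{St}(n,r)$, where $X\mapsto g(X,\zeta)$ is $\tau$-weakly convex on $\mathbb{R}^{n\times r}$ ($\tau\ge0$) for each realization $\zeta$, $f$ is finite-valued on $\mathbb{R}^{n\times r}$, and there exists a bounded open convex set $\mathcal{U}$ containing $\mathrm{St}(n,r)$ such that $X\mapsto g(X,\zeta)$ is Lipschitz continuous on $\mathcal{U}$ with some constant $L(\zeta)>0$ satisfying $L^2:=\mathbb{E}_{\zeta\sim D}[L(\zeta)^2]<+\infty$ ($L>0$). Suppose that a Riemannian stochastic subgradient oracle is available, and let $\{X_k\}$ be the sequence generated by the Riemannian stochastic subgradient method with arbitrary initialization $X_0\in\mathrm{St}(n,r)$. Let $0<\lambda<\frac{1}{L+\tau}$. Suppose that the constant stepsize $\gamma_k=\frac{1}{\sqrt{T+1}}$, $k=0,1,\dots$, is chosen, with $T$ being the total number of iterations, and that the algorithm returns $X_{\overline k}$ with $\overline k$ sampled from $\{0,1,\dots,T\}$ uniformly at random (independently of the samples drawn by the oracle). Then $$\mathbb{E}\left[\Theta^2(X_{\overline k})\right]\le\frac{1}{\lambda\left(\frac1\lambda-(L+\tau)\right)}\cdot\frac{2\big(f_\lambda(X_0)-\min f_\lambda\big)+\frac{L^2}{\lambda}}{\sqrt{T+1}},$$ where the expectation is taken over all random choices made by the algorithm.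
   Context: $\mathrm{St}(n,r)=\{X\in\mathbb{R}^{n\times r}: X^\top X=I_r\}$, with tangent space $T_X\mathrm{St}=\{\xi:\xi^\top X+X^\top\xi=0\}$; $\langle A,B\rangle=\mathrm{trace}(A^\top B)$, $\|A\|_F=\sqrt{\langle A,A\rangle}$. A function $h$ is $\tau$-weakly convex if $q:=h+\frac\tau2\|\cdot\|_F^2$ is convex; its Euclidean subdifferential is $\partial h(X)=\partial q(X)-\tau X$ ($\partial q$ the convex subdifferential), and its Riemannian subdifferential at $X\in\mathrm{St}(n,r)$ is $\partial_{\mathcal R}h(X)=\mathcal{P}_{T_X\mathrm{St}}(\partial h(X))$, with $\mathcal{P}_{T_X\mathrm{St}}(B)=B-\frac12X(B^\top X+X^\top B)$. Subdifferentials of $g(X,\zeta)$ are with respect to $X$. Riemannian stochastic subgradient oracle: (a) it can generate i.i.d. samples according to $D$; (b) given $X\in\mathrm{St}(n,r)$, it generates $\zeta\sim D$ and returns a stochastic subgradient $\widetilde\nabla g(X,\zeta)\in\partial g(X,\zeta)$ with $\mathbb{E}_{\zeta\sim D}[\widetilde\nabla g(X,\zeta)]\in\partial f(X)$, from which one obtains the Riemannian stochastic subgradient $\widetilde\nabla_{\mathcal R}g(X,\zeta)=\mathcal{P}_{T_X\mathrm{St}}(\widetilde\nabla g(X,\zeta))\in\partial_{\mathcal R}g(X,\zeta)$ with $\mathbb{E}_{\zeta\sim D}[\widetilde\nabla_{\mathcal R}g(X,\zeta)]\in\partial_{\mathcal R}f(X)$. Riemannian stochastic subgradient method with stepsizes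 $\gamma_k>0$: at $X_k$ the oracle draws $\zeta_k\sim D$ independent of $\{\zeta_0,\dots,\zeta_{k-1}\}$, and $X_{k+1}=\mathrm{Retr}_{X_k}(-\gamma_k\widetilde\nabla_{\mathcal R}g(X_k,\zeta_k))$, where $\mathrm{Retr}_X(\xi)=(X+\xi)(I_r+\xi^\top\xi)^{-1/2}$ is the polar retraction. For $X\in\mathrm{St}(n,r)$: $f_\lambda(X)=\min_{Y\in\mathrm{St}(n,r)}\{f(Y)+\frac1{2\lambda}\|Y-X\|_F^2\}$, $P_{\lambda f}(X)$ is any (arbitrarily chosen) element of $\mathrm{argmin}_{Y\in\mathrm{St}(n,r)}\{f(Y)+\frac1{2\lambda}\|Y-X\|_F^2\}$, and $\Theta(X)=\lambda^{-1}\|P_{\lambda f}(X)-X\|_F$. $\min f_\lambda$ denotes the minimum of $f_\lambda$ over $\mathrm{St}(n,r)$. *)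

theory Defs
  imports "HOL-Probability.Probability"
begin

text \<open>
  An n-by-r matrix is an element of \<^typ>\<open>real^'r^'n\<close>.  The library inner product and norm on
  this type are the trace inner product and the Frobenius norm.
\<close>

lemma inner_matrix_eq_trace:
  fixes A B :: "real^'r^'n"
  shows "A \<bullet> B = trace (transpose A ** B)"
proof -
  have "A \<bullet> B = (\<Sum>i\<in>UNIV. \<Sum>j\<in>UNIV. A $ i $ j * B $ i $ j)"
    by (simp add: inner_vec_def)
  also have "\<dots> = (\<Sum>j\<in>UNIV. \<Sum>i\<in>UNIV. A $ i $ j * B $ i $ j)"
    by (rule sum.swap)
  also have "\<dots> = trace (transpose A ** B)"
    by (simp add: trace_def matrix_matrix_mult_def transpose_def)
  finally show ?thesis .
qed

lemma norm_matrix_eq_Frobenius: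
  fixes A :: "real^'r^'n"
  shows "norm A = sqrt (trace (transpose A ** A))"
  by (simp add: norm_eq_sqrt_inner inner_matrix_eq_trace)

definition Stiefel :: "(real^'r^'n) set" where
  "Stiefel = {X. transpose X ** X = mat 1}"

definition tangent_proj :: "real^'r^'n \<Rightarrow> real^'r^'n \<Rightarrow> real^'r^'n" where
  "tangent_proj X B = B - (1/2) *\<^sub>R (X ** (transpose B ** X + transpose X ** B))"

definition posdef_matrix :: "real^'r^'r \<Rightarrow> bool" where
  "posdef_matrix S \<longleftrightarrow> transpose S = S \<and> (\<forall>v. v \<noteq> 0 \<longrightarrow> v \<bullet> (S *v v) > 0)"

text \<open>Meaningful for positive definite arguments, which have a unique positive definite root.\<close>

definition matrix_sqrt :: "real^'r^'r \<Rightarrow> real^'r^'r" where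
  "matrix_sqrt A = (THE S. posdef_matrix S \<and> S ** S = A)"

definition polar_retr :: "real^'r^'n \<Rightarrow> real^'r^'n \<Rightarrow> real^'r^'n" where
  "polar_retr X \<xi> = (X + \<xi>) ** matrix_inv (matrix_sqrt (mat 1 + transpose \<xi> ** \<xi>))"

definition weakly_convex :: "real \<Rightarrow> ('a::real_inner \<Rightarrow> real) \<Rightarrow> bool" where
  "weakly_convex \<tau> h \<longleftrightarrow> convex_on UNIV (\<lambda>X. h X + \<tau> / 2 * (norm X)\<^sup>2)"

definition convex_subdiff :: "('a::real_inner \<Rightarrow> real) \<Rightarrow> 'a \<Rightarrow> 'a set" where
  "convex_subdiff q X = {V. \<forall>Y. q Y \<ge> q X + V \<bullet> (Y - X)}"

definition subdiff :: "real \<Rightarrow> ('a::real_inner \<Rightarrow> real) \<Rightarrow> 'a \<Rightarrow> 'a set" where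
  "subdiff \<tau> h X = (\<lambda>V. V - \<tau> *\<^sub>R X) ` convex_subdiff (\<lambda>Y. h Y + \<tau> / 2 * (norm Y)\<^sup>2) X"

definition riem_subdiff :: "real \<Rightarrow> (real^'r^'n \<Rightarrow> real) \<Rightarrow> real^'r^'n \<Rightarrow> (real^'r^'n) set" where
  "riem_subdiff \<tau> h X = tangent_proj X ` subdiff \<tau> h X"

text \<open>
  The oracle is a map \<open>G\<close>: queried at \<open>X\<close> it draws \<open>z\<close> from \<open>D\<close> and returns \<open>G X z\<close>.  The
  joint measurability makes the iterates of the method random variables, and makes the
  expectation over a fresh sample at a random query point meaningful.
\<close>

definition stoch_subgrad_oracle ::
  "'z measure \<Rightarrow> real \<Rightarrow> (real^'r^'n \<Rightarrow> 'z \<Rightarrow> real) \<Rightarrow> (real^'r^'n \<Rightarrow> 'z \<Rightarrow> real^'r^'n) \<Rightarrow> bool" where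
  "stoch_subgrad_oracle D \<tau> g G \<longleftrightarrow>
     (\<lambda>(X, z). G X z) \<in> borel_measurable (restrict_space borel Stiefel \<Otimes>\<^sub>M D) \<and>
     (\<forall>X\<in>Stiefel. (\<forall>z\<in>space D. G X z \<in> subdiff \<tau> (\<lambda>Y. g Y z) X) \<and>
        integrable D (G X) \<and>
        (LINT z|D. G X z) \<in> subdiff \<tau> (\<lambda>Y. LINT z|D. g Y z) X)"

definition riem_stoch_subgrad ::
  "(real^'r^'n \<Rightarrow> 'z \<Rightarrow> real^'r^'n) \<Rightarrow> real^'r^'n \<Rightarrow> 'z \<Rightarrow> real^'r^'n" where
  "riem_stoch_subgrad G X z = tangent_proj X (G X z)"

lemma linear_tangent_proj:
  fixes X :: "real^'r^'n"
  shows "linear (tangent_proj X)"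
proof (rule linearI)
  fix A B :: "real^'r^'n" and c :: real
  have t: "transpose (A + B) = transpose A + transpose B"
    "transpose (c *\<^sub>R A) = c *\<^sub>R transpose A"
    by (simp_all add: transpose_def vec_eq_iff)
  have d: "(transpose A + transpose B) ** X = transpose A ** X + transpose B ** X"
    by (simp add: matrix_matrix_mult_def vec_eq_iff sum.distrib algebra_simps)
  show "tangent_proj X (A + B) = tangent_proj X A + tangent_proj X B"
    by (simp add: tangent_proj_def t matrix_add_ldistrib d scaleR_add_right)
  have l: "X ** (c *\<^sub>R N) = c *\<^sub>R (X ** N)" for N :: "real^'r^'r"
    by (simp add: matrix_matrix_mult_def vec_eq_iff sum_distrib_left algebra_simps)
  have r: "(c *\<^sub>R transpose A) ** X = c *\<^sub>R (transpose A ** X)"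
    "transpose X ** (c *\<^sub>R A) = c *\<^sub>R (transpose X ** A)"
    by (simp_all add: matrix_matrix_mult_def vec_eq_iff sum_distrib_left algebra_simps)
  have "tangent_proj X (c *\<^sub>R A)
      = c *\<^sub>R A - (1/2) *\<^sub>R (X ** (c *\<^sub>R (transpose A ** X + transpose X ** A)))"
    by (simp only: tangent_proj_def t r scaleR_add_right)
  then show "tangent_proj X (c *\<^sub>R A) = c *\<^sub>R tangent_proj X A"
    by (simp add: tangent_proj_def l scaleR_diff_right)
qed

lemma riem_stoch_subgrad_oracle:
  assumes "stoch_subgrad_oracle D \<tau> g G" and "X \<in> Stiefel"
  shows "z \<in> space D \<Longrightarrow> riem_stoch_subgrad G X z \<in> riem_subdiff \<tau> (\<lambda>Y. g Y z) X"
    and "(LINT z|D. riem_stoch_subgrad G X z) \<in> riem_subdiff \<tau> (\<lambda>Y. LINT z|D. g Y z) X"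
proof -
  have int: "integrable D (G X)" and mem: "(LINT z|D. G X z) \<in> subdiff \<tau> (\<lambda>Y. LINT z|D. g Y z) X"
    and sub: "\<And>z. z \<in> space D \<Longrightarrow> G X z \<in> subdiff \<tau> (\<lambda>Y. g Y z) X"
    using assms by (auto simp: stoch_subgrad_oracle_def)
  show "z \<in> space D \<Longrightarrow> riem_stoch_subgrad G X z \<in> riem_subdiff \<tau> (\<lambda>Y. g Y z) X"
    using sub by (auto simp: riem_stoch_subgrad_def riem_subdiff_def)
  have "bounded_linear (tangent_proj X)"
    using linear_tangent_proj linear_conv_bounded_linear by blast
  then have "(LINT z|D. riem_stoch_subgrad G X z) = tangent_proj X (LINT z|D. G X z)"
    unfolding riem_stoch_subgrad_def using int by (rule integral_bounded_linear)
  then show "(LINT z|D. riem_stoch_subgrad G X z) \<in> riem_subdiff \<tau> (\<lambda>Y. LINT z|D. g Y z) X"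
    using mem by (auto simp: riem_subdiff_def)
qed

primrec rssm_iterate ::
  "(real^'r^'n \<Rightarrow> 'z \<Rightarrow> real^'r^'n) \<Rightarrow> (nat \<Rightarrow> real) \<Rightarrow> real^'r^'n \<Rightarrow> (nat \<Rightarrow> 'z) \<Rightarrow> nat \<Rightarrow> real^'r^'n"
where
  "rssm_iterate G \<gamma> X0 zs 0 = X0"
| "rssm_iterate G \<gamma> X0 zs (Suc k) =
     polar_retr (rssm_iterate G \<gamma> X0 zs k)
       (- (\<gamma> k *\<^sub>R riem_stoch_subgrad G (rssm_iterate G \<gamma> X0 zs k) (zs k)))"

definition prox_objective ::
  "real \<Rightarrow> (real^'r^'n \<Rightarrow> real) \<Rightarrow> real^'r^'n \<Rightarrow> real^'r^'n \<Rightarrow> real" where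
  "prox_objective lam f X Y = f Y + 1 / (2 * lam) * (norm (Y - X))\<^sup>2"

text \<open>
  For continuous \<open>f\<close> the infimum is a minimum, because the Stiefel manifold is compact.
\<close>

definition moreau_env :: "real \<Rightarrow> (real^'r^'n \<Rightarrow> real) \<Rightarrow> real^'r^'n \<Rightarrow> real" where
  "moreau_env lam f X = (INF Y\<in>Stiefel. prox_objective lam f X Y)"

definition is_prox_selection ::
  "real \<Rightarrow> (real^'r^'n \<Rightarrow> real) \<Rightarrow> (real^'r^'n \<Rightarrow> real^'r^'n) \<Rightarrow> bool" where
  "is_prox_selection lam f P \<longleftrightarrow>
     (\<forall>X\<in>Stiefel. is_arg_min (prox_objective lam f X) (\<lambda>Y. Y \<in> Stiefel) (P X))"

definition Theta :: "real \<Rightarrow> (real^'r^'n \<Rightarrow> real^'r^'n) \<Rightarrow> real^'r^'n \<Rightarrow> real" where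
  "Theta lam P X = norm (P X - X) / lam"

text \<open>
  An arbitrarily chosen proximal point need not depend measurably on its argument.  The library
  integral \<^const>\<open>nn_integral\<close> is a supremum over simple functions below the integrand, so for a
  non-measurable integrand an upper bound on it says little.  The upper integral gives such bounds
  their full strength, and is the usual integral when the integrand is measurable.
\<close>

definition upper_nn_integral :: "'w measure \<Rightarrow> ('w \<Rightarrow> ennreal) \<Rightarrow> ennreal" where
  "upper_nn_integral M F =
     (INF h\<in>{h \<in> borel_measurable M. \<forall>\<omega>\<in>space M. F \<omega> \<le> h \<omega>}. \<integral>\<^sup>+\<omega>. h \<omega> \<partial>M)"

lemma upper_nn_integral_measurable:
  assumes "F \<in> borel_measurable M"
  shows "upper_nn_integral M F = (\<integral>\<^sup>+\<omega>. F \<omega> \<partial>M)"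
  unfolding upper_nn_integral_def
proof (rule antisym)
  show "(INF h\<in>{h \<in> borel_measurable M. \<forall>\<omega>\<in>space M. F \<omega> \<le> h \<omega>}. \<integral>\<^sup>+\<omega>. h \<omega> \<partial>M)
      \<le> (\<integral>\<^sup>+\<omega>. F \<omega> \<partial>M)"
    using assms by (intro INF_lower) auto
  show "(\<integral>\<^sup>+\<omega>. F \<omega> \<partial>M)
      \<le> (INF h\<in>{h \<in> borel_measurable M. \<forall>\<omega>\<in>space M. F \<omega> \<le> h \<omega>}. \<integral>\<^sup>+\<omega>. h \<omega> \<partial>M)"
    by (intro INF_greatest nn_integral_mono) auto
qed

end

theory Submission
  imports Defs
begin

text \<open>
  The bound is a descent estimate for the Moreau envelope \<open>f_lam\<close> on the manifold.  Let \<open>x\<close> be an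
  iterate, \<open>p = P x\<close> its proximal point, \<open>\<xi>\<close> the projected stochastic subgradient, \<open>c\<close> the stepsize and
  \<open>x'\<close> the next iterate.  Since \<open>p\<close> competes in the minimum defining \<open>f_lam x'\<close>,
  \<open>f_lam x' \<le> f p + (norm (p - x'))\<^sup>2 / (2 * lam)\<close>.  The polar retraction of a tangent step moves no point
  of the manifold farther away (\<open>polar_retr_nonexpansive\<close>), so \<open>x'\<close> may be replaced by \<open>x - c *\<^sub>R \<xi>\<close>, and
  expanding the square leaves \<open>f_lam x\<close>, a linear term \<open>(c / lam) * (\<xi> \<bullet> (p - x))\<close> and a term of order
  \<open>c\<^sup>2\<close> (\<open>moreau_env_step_le\<close>).

  Averaging over the sample turns \<open>\<xi>\<close> into the projection of a subgradient of \<open>f\<close> of norm at most \<open>L\<close>.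
  A chord of the manifold meets normal directions only to second order (\<open>inner_Stiefel_diff\<close>), so
  projecting the subgradient costs only \<open>L / 2\<close> times the squared chord length, and
  \<open>riemannian_subgradient_inequality\<close> bounds the mean of \<open>\<xi> \<bullet> (p - x)\<close> by
  \<open>f p - f x + (L + \<tau>) / 2 * (norm (p - x))\<^sup>2\<close>.  Comparing \<open>p\<close> with \<open>x\<close> in the proximal problem gives
  \<open>f p - f x \<le> - (norm (p - x))\<^sup>2 / (2 * lam)\<close>.  As \<open>1 / lam > L + \<tau>\<close>, a positive multiple of \<open>Theta\<^sup>2\<close> is
  dominated by the expected decrease of \<open>f_lam\<close> plus \<open>c\<^sup>2 * L\<^sup>2 / (2 * lam)\<close>
  (\<open>Theta_square_le_majorant\<close>).  The decreases telescope along the iterates, and the uniformly random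
  index turns their sum into an average.

  Two points need care.  The retraction contains the inverse of a matrix square root.  That root
  exists, is unique, and yields a map measurable in the iterate and the sample because the polar
  factor of \<open>Z\<close> is the unique maximiser of \<open>\<lambda>Y. Y \<bullet> Z\<close> over the manifold (\<open>polar_decomposition\<close>,
  \<open>matrix_sqrt_gram\<close>, \<open>continuous_on_polar_factor\<close>); compactness supplies existence and continuity.
  Second, \<open>Theta\<close> need not be measurable, since proximal points are chosen arbitrarily.  The upper bound
  in the one-step inequality, \<open>Theta_majorant\<close>, is measurable and dominates \<open>Theta\<^sup>2\<close> at every point of
  the manifold, so its integral bounds the upper integral of \<open>Theta\<^sup>2\<close>.
\<close>

section \<open>Products of matrices and the trace inner product\<close>

lemma bounded_bilinear_matrix_mult:
  "bounded_bilinear ((**) :: real^'m^'n \<Rightarrow> real^'r^'m \<Rightarrow> real^'r^'n)"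
proof -
  have "bilinear ((**) :: real^'m^'n \<Rightarrow> real^'r^'m \<Rightarrow> real^'r^'n)"
    unfolding bilinear_def
    by (auto intro!: linearI simp: matrix_matrix_mult_def vec_eq_iff algebra_simps sum.distrib
        sum_distrib_left)
  then show ?thesis
    using bilinear_conv_bounded_bilinear by blast
qed

lemmas matrix_mult_simps =
  bounded_bilinear.diff_left[OF bounded_bilinear_matrix_mult]
  bounded_bilinear.diff_right[OF bounded_bilinear_matrix_mult]
  bounded_bilinear.add_left[OF bounded_bilinear_matrix_mult]
  bounded_bilinear.add_right[OF bounded_bilinear_matrix_mult]
  bounded_bilinear.scaleR_left[OF bounded_bilinear_matrix_mult]
  bounded_bilinear.scaleR_right[OF bounded_bilinear_matrix_mult]
  bounded_bilinear.minus_left[OF bounded_bilinear_matrix_mult]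
  bounded_bilinear.minus_right[OF bounded_bilinear_matrix_mult]
lemmas continuous_on_matrix_mult [continuous_intros] =
  bounded_bilinear.continuous_on[OF bounded_bilinear_matrix_mult]

lemma transpose_linear_simps:
  fixes A B :: "real^'r^'n"
  shows "transpose (A + B) = transpose A + transpose B"
    "transpose (A - B) = transpose A - transpose B"
    "transpose (- A) = - transpose A"
    "transpose (c *\<^sub>R A) = c *\<^sub>R transpose A"
  by (simp_all add: transpose_def vec_eq_iff)

lemma continuous_on_transpose [continuous_intros]:
  fixes h :: "'a::topological_space \<Rightarrow> real^'r^'n"
  assumes "continuous_on S h"
  shows "continuous_on S (\<lambda>x. transpose (h x))"
proof -
  have "linear (transpose :: real^'r^'n \<Rightarrow> real^'n^'r)"
    by (rule linearI) (simp_all add: transpose_linear_simps)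
  then show ?thesis
    unfolding linear_conv_bounded_linear by (rule bounded_linear.continuous_on) (rule assms)
qed

lemma inner_mult_left:
  fixes A :: "real^'m^'n" and B :: "real^'r^'m" and C :: "real^'r^'n"
  shows "(A ** B) \<bullet> C = B \<bullet> (transpose A ** C)"
  by (simp add: inner_matrix_eq_trace matrix_transpose_mul matrix_mul_assoc)

lemma inner_transpose:
  fixes A B :: "real^'r^'n"
  shows "transpose A \<bullet> transpose B = A \<bullet> B"
  unfolding inner_vec_def transpose_def
  by (simp add: sum.swap[of "\<lambda>i j. A $ j $ i * B $ j $ i"])

lemma norm_transpose:
  fixes A :: "real^'r^'n"
  shows "norm (transpose A) = norm A"
  by (simp add: norm_eq_sqrt_inner inner_transpose)

lemma matrix_mult_row: "(A ** B) $ i = transpose B *v (A $ i)"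
  for A :: "real^'m^'n" and B :: "real^'r^'m"
  by (simp add: vec_eq_iff matrix_matrix_mult_def matrix_vector_mult_def transpose_def mult.commute)

lemma norm_square_rows:
  fixes A :: "real^'r^'n"
  shows "(norm A)\<^sup>2 = (\<Sum>i\<in>UNIV. (norm (A $ i))\<^sup>2)"
  by (simp add: power2_norm_eq_inner inner_vec_def)

lemma norm_matrix_vector_mult_le:
  fixes A :: "real^'r^'n"
  shows "norm (A *v v) \<le> norm A * norm v"
proof -
  have "(norm (A *v v))\<^sup>2 = (\<Sum>i\<in>UNIV. (A $ i \<bullet> v)\<^sup>2)"
    unfolding power2_norm_eq_inner inner_vec_def[of "A *v v"]
    by (simp add: matrix_vector_mul_component power2_eq_square)
  also have "\<dots> \<le> (\<Sum>i\<in>UNIV. (norm (A $ i))\<^sup>2 * (norm v)\<^sup>2)"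
  proof (rule sum_mono)
    fix i
    show "(A $ i \<bullet> v)\<^sup>2 \<le> (norm (A $ i))\<^sup>2 * (norm v)\<^sup>2"
      using Cauchy_Schwarz_ineq[of "A $ i" v] by (simp add: power2_norm_eq_inner)
  qed
  also have "\<dots> = (norm A * norm v)\<^sup>2"
    by (simp add: norm_square_rows sum_distrib_right power_mult_distrib)
  finally show ?thesis
    by (rule power2_le_imp_le) simp
qed

lemma norm_matrix_mult_le:
  fixes A :: "real^'m^'n" and B :: "real^'r^'m"
  shows "norm (A ** B) \<le> norm A * norm B"
proof -
  have "(norm (A ** B))\<^sup>2 = (\<Sum>i\<in>UNIV. (norm (transpose B *v (A $ i)))\<^sup>2)"
    by (simp add: norm_square_rows matrix_mult_row)
  also have "\<dots> \<le> (\<Sum>i\<in>UNIV. (norm B * norm (A $ i))\<^sup>2)"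
    using norm_matrix_vector_mult_le[of "transpose B"]
    by (intro sum_mono power_mono) (auto simp: norm_transpose)
  also have "\<dots> = (norm A * norm B)\<^sup>2"
    by (simp add: norm_square_rows[of A] sum_distrib_left power_mult_distrib mult.commute)
  finally show ?thesis
    by (rule power2_le_imp_le) simp
qed

text \<open>
  Reduces the sign of \<open>(A ** S) \<bullet> A\<close> to the quadratic form of \<open>S\<close> on the rows of \<open>A\<close>, so that
  semidefiniteness of \<open>S\<close> can be used on rectangular matrices.
\<close>

lemma inner_mult_rows:
  fixes A :: "real^'r^'n" and S :: "real^'r^'r"
  assumes "transpose S = S"
  shows "(A ** S) \<bullet> A = (\<Sum>i\<in>UNIV. (A $ i) \<bullet> (S *v (A $ i)))"
  unfolding inner_vec_def[of "A ** S"] by (simp add: matrix_mult_row assms inner_commute)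

section \<open>The Stiefel manifold\<close>

lemma Stiefel_D: "X \<in> Stiefel \<Longrightarrow> transpose X ** X = mat 1"
  by (simp add: Stiefel_def)

lemma Stiefel_mult_cancel:
  "X \<in> Stiefel \<Longrightarrow> transpose X ** (X ** (A :: real^'s^'r)) = A"
  by (simp add: Stiefel_def matrix_mul_assoc)

lemma norm_Stiefel: 
  fixes X :: "real^'r^'n"
  assumes "X \<in> Stiefel" shows "(norm X)\<^sup>2 = real CARD('r)"
  using assms by (simp add: norm_matrix_eq_Frobenius Stiefel_def trace_def mat_def)

lemma compact_Stiefel: "compact (Stiefel :: (real^'r^'n) set)"
proof -
  have "closed (Stiefel :: (real^'r^'n) set)"
    unfolding Stiefel_def by (intro closed_Collect_eq continuous_intros)
  moreover have "bounded (Stiefel :: (real^'r^'n) set)"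
  proof (rule boundedI)
    fix X :: "real^'r^'n"
    assume "X \<in> Stiefel"
    then show "norm X \<le> sqrt (real CARD('r))"
      by (simp add: norm_Stiefel real_le_rsqrt)
  qed
  ultimately show ?thesis
    by (simp add: compact_eq_bounded_closed)
qed

lemma Stiefel_gram_diff:
  fixes X Y :: "real^'r^'n"
  assumes "X \<in> Stiefel" "Y \<in> Stiefel"
  shows "transpose (Y - X) ** (Y - X) = - (transpose X ** (Y - X) + transpose (Y - X) ** X)"
  unfolding transpose_linear_simps matrix_mult_simps Stiefel_D[OF assms(1)] Stiefel_D[OF assms(2)]
  by simp

text \<open>
  Matrices \<open>X ** S\<close> with \<open>S\<close> symmetric are the normal directions at \<open>X\<close>.  Because \<open>X\<close> and \<open>Y\<close> have the
  same Gram matrix, the symmetric part of \<open>X\<^sup>T (Y - X)\<close> is minus one half of the Gram matrix of \<open>Y - X\<close>;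
  so a chord of the manifold meets normal directions only to second order.  Both the nonexpansiveness
  of the retraction and the subgradient inequality on the manifold rest on this identity.
\<close>

lemma inner_Stiefel_diff:
  fixes X Y :: "real^'r^'n" and S :: "real^'r^'r"
  assumes "X \<in> Stiefel" "Y \<in> Stiefel" "transpose S = S"
  shows "(X ** S) \<bullet> (Y - X) = - (1/2) * (((Y - X) ** S) \<bullet> (Y - X))"
proof -
  let ?D = "Y - X"
  have "(?D ** S) \<bullet> ?D = S \<bullet> (transpose ?D ** ?D)"
    by (rule inner_mult_left)
  also have "\<dots> = - (S \<bullet> (transpose X ** ?D)) - S \<bullet> (transpose ?D ** X)"
    unfolding Stiefel_gram_diff[OF assms(1,2)] by (simp add: inner_diff_right inner_add_right)
  also have "S \<bullet> (transpose ?D ** X) = S \<bullet> (transpose X ** ?D)"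
    using inner_transpose[of S "transpose X ** ?D"] assms(3) by (simp add: matrix_transpose_mul)
  also have "S \<bullet> (transpose X ** ?D) = (X ** S) \<bullet> ?D"
    by (simp add: inner_mult_left)
  finally show ?thesis by simp
qed

section \<open>Polar decomposition by maximisation over the Stiefel manifold\<close>

definition full_column_rank :: "real^'r^'n \<Rightarrow> bool" where
  "full_column_rank Z \<longleftrightarrow> (\<forall>v. v \<noteq> 0 \<longrightarrow> Z *v v \<noteq> 0)"

text \<open>
  By the chord identity, passing from \<open>Y\<close> to \<open>W\<close> lowers the value by half the quadratic form of \<open>S\<close>
  on \<open>W - Y\<close>.  Hence a polar factor is determined by the matrix: it is the only maximiser of the
  pairing with it.
\<close>

lemma polar_factor_strict_max:
  fixes Y W :: "real^'r^'n"
  assumes Y: "Y \<in> Stiefel" and W: "W \<in> Stiefel" and S: "posdef_matrix S" and "W \<noteq> Y"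
  shows "W \<bullet> (Y ** S) < Y \<bullet> (Y ** S)"
proof -
  have sym: "transpose S = S" and pos: "\<And>v. v \<noteq> 0 \<Longrightarrow> v \<bullet> (S *v v) > 0"
    using S by (auto simp: posdef_matrix_def)
  let ?D = "W - Y"
  obtain i where i: "?D $ i \<noteq> 0"
    using \<open>W \<noteq> Y\<close> by (auto simp: vec_eq_iff)
  have "0 < (\<Sum>i\<in>UNIV. (?D $ i) \<bullet> (S *v (?D $ i)))"
  proof (rule sum_pos2[of _ i])
    show "0 \<le> (?D $ j) \<bullet> (S *v (?D $ j))" for j
      using pos[of "?D $ j"] by (cases "?D $ j = 0") auto
  qed (use pos[OF i] in auto)
  then have "0 < (?D ** S) \<bullet> ?D"
    by (simp add: inner_mult_rows sym)
  moreover have "(Y ** S) \<bullet> ?D = - (1/2) * ((?D ** S) \<bullet> ?D)"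
    by (rule inner_Stiefel_diff[OF Y W sym])
  ultimately show ?thesis
    by (simp add: inner_diff_right inner_commute)
qed

text \<open>
  Optimality against the rotations of \<open>Y\<close> in the plane of the coordinates \<open>i\<close> and \<open>j\<close>.  Such a
  rotation by \<open>(c, s)\<close> changes the part \<open>a\<close> of the objective into \<open>c * a + s * b\<close>, whose maximum over
  the unit circle is \<open>sqrt (a\<^sup>2 + b\<^sup>2)\<close>; no gain is possible only if \<open>b = 0\<close>.  The conclusion says that
  \<open>Y ** transpose Z\<close> is symmetric.
\<close>

lemma Stiefel_max_symmetric:
  fixes Y Z :: "real^'r^'n"
  assumes Y: "Y \<in> Stiefel" and max: "\<And>W. W \<in> Stiefel \<Longrightarrow> W \<bullet> Z \<le> Y \<bullet> Z"
  shows "Y $ i \<bullet> Z $ j = Y $ j \<bullet> Z $ i"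
proof (cases "i = j")
  case False
  define a b where "a = Y $ i \<bullet> Z $ i + Y $ j \<bullet> Z $ j" and "b = Y $ j \<bullet> Z $ i - Y $ i \<bullet> Z $ j"
  have rot: "c * a + s * b \<le> a" if cs: "c\<^sup>2 + s\<^sup>2 = 1" for c s
  proof -
    define W where "W = (\<chi> k. if k = i then c *\<^sub>R Y $ i + s *\<^sub>R Y $ j
                       else if k = j then c *\<^sub>R Y $ j - s *\<^sub>R Y $ i else Y $ k)"
    have W: "W $ i = c *\<^sub>R Y $ i + s *\<^sub>R Y $ j" "W $ j = c *\<^sub>R Y $ j - s *\<^sub>R Y $ i"
       "\<And>k. k \<noteq> i \<Longrightarrow> k \<noteq> j \<Longrightarrow> W $ k = Y $ k"
      using False by (simp_all add: W_def)
    have split: "sum h UNIV = h i + h j + sum h (UNIV - {i,j})" for h :: "'n \<Rightarrow> real"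
    proof -
      have "sum h UNIV = sum h {i,j} + sum h (UNIV - {i,j})"
        by (subst sum.union_disjoint[symmetric]) auto
      then show ?thesis using False by simp
    qed
    have "(transpose W ** W) $ p $ q = (transpose Y ** Y) $ p $ q" for p q
    proof -
      have "W $ i $ p * W $ i $ q + W $ j $ p * W $ j $ q
          = (c\<^sup>2 + s\<^sup>2) * (Y $ i $ p * Y $ i $ q + Y $ j $ p * Y $ j $ q)"
        by (simp add: W power2_eq_square algebra_simps)
      moreover have "(\<Sum>k\<in>UNIV - {i,j}. W $ k $ p * W $ k $ q)
          = (\<Sum>k\<in>UNIV - {i,j}. Y $ k $ p * Y $ k $ q)"
        by (intro sum.cong) (auto simp: W)
      ultimately show ?thesis
        by (simp add: matrix_matrix_mult_def transpose_def split cs)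
    qed
    then have "W \<in> Stiefel"
      using Y by (simp add: Stiefel_def vec_eq_iff)
    then have "W \<bullet> Z \<le> Y \<bullet> Z" by (rule max)
    moreover have "(\<Sum>k\<in>UNIV - {i,j}. W $ k \<bullet> Z $ k) = (\<Sum>k\<in>UNIV - {i,j}. Y $ k \<bullet> Z $ k)"
      by (intro sum.cong) (auto simp: W)
    ultimately show ?thesis
      by (simp add: inner_vec_def[of W] inner_vec_def[of Y] split W a_def b_def algebra_simps
          inner_add_left inner_diff_left)
  qed
  have "b = 0"
  proof (rule ccontr)
    assume "b \<noteq> 0"
    \<comment> \<open>The rotation that attains the maximum over the unit circle.\<close>
    define R where "R = sqrt (a\<^sup>2 + b\<^sup>2)"
    have R2: "R\<^sup>2 = a\<^sup>2 + b\<^sup>2" and R: "R > 0"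
      using \<open>b \<noteq> 0\<close> by (auto simp: R_def sum_power2_gt_zero_iff)
    have "(a/R)\<^sup>2 + (b/R)\<^sup>2 = 1"
      using R by (simp add: power_divide add_divide_distrib[symmetric] R2[symmetric])
    from rot[OF this] have "R\<^sup>2 \<le> a * R"
      unfolding R2 using R by (simp add: field_simps power2_eq_square)
    then have "R \<le> a"
      using R by (simp add: power2_eq_square mult.commute[of a])
    then have "R\<^sup>2 \<le> a\<^sup>2"
      using R by (intro power_mono) auto
    then show False using R2 \<open>b \<noteq> 0\<close> by simp
  qed
  then show ?thesis by (simp add: b_def)
qed simp

text \<open>
  Optimality against the reflection of the columns along \<open>v\<close>: \<open>Q\<close> is the Householder matrix of \<open>v\<close>, and
  replacing \<open>Y\<close> by \<open>Y ** Q\<close> changes the objective by a negative multiple of \<open>(Y *v v) \<bullet> (Z *v v)\<close>.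
\<close>

lemma Stiefel_max_semidefinite:
  fixes Y Z :: "real^'r^'n"
  assumes Y: "Y \<in> Stiefel" and max: "\<And>W. W \<in> Stiefel \<Longrightarrow> W \<bullet> Z \<le> Y \<bullet> Z"
  shows "(Y *v v) \<bullet> (Z *v v) \<ge> 0"
proof (cases "v = 0")
  case False
  define V :: "real^'r^'r" where "V = (\<chi> i j. v $ i * v $ j)"
  define k where "k = 2 / (v \<bullet> v)"
  define Q :: "real^'r^'r" where "Q = mat 1 - k *\<^sub>R V"
  have vv: "v \<bullet> v > 0" using False by simp
  have k: "k > 0" and kk: "k * (k * (v \<bullet> v)) = k + k"
    using vv by (simp_all add: k_def)
  have tV: "transpose V = V" by (simp add: V_def transpose_def vec_eq_iff mult.commute)
  have VV: "V ** V = (v \<bullet> v) *\<^sub>R V"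
    by (simp add: V_def matrix_matrix_mult_def vec_eq_iff inner_vec_def sum_distrib_left mult_ac)
  have "transpose Q ** Q = mat 1 - k *\<^sub>R V - k *\<^sub>R V + (k * (k * (v \<bullet> v))) *\<^sub>R V"
    by (simp add: Q_def transpose_linear_simps tV matrix_mult_simps VV
        scaleR_diff_right)
  also have "\<dots> = mat 1"
    unfolding kk scaleR_left_distrib by simp
  finally have "transpose Q ** Q = mat 1" .
  then have "Y ** Q \<in> Stiefel"
    using Y by (simp add: Stiefel_def matrix_transpose_mul Stiefel_mult_cancel[OF Y] matrix_mul_assoc[symmetric])
  then have "(Y ** Q) \<bullet> Z \<le> Y \<bullet> Z" by (rule max)
  moreover have "(Y ** Q) \<bullet> Z = Y \<bullet> Z - k * ((Y ** V) \<bullet> Z)"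
    by (simp add: Q_def matrix_mult_simps inner_diff_left)
  ultimately have "(Y ** V) \<bullet> Z \<ge> 0"
    using k by (simp add: zero_le_mult_iff)
  also have "(Y ** V) \<bullet> Z = (Y *v v) \<bullet> (Z *v v)"
  proof -
    have "(Y ** V) $ i $ j = (Y *v v) $ i * v $ j" for i j
      by (simp add: V_def matrix_matrix_mult_def matrix_vector_mult_def sum_distrib_right mult.assoc)
    then have "(Y ** V) $ i \<bullet> Z $ i = (Y *v v) $ i * (Z *v v) $ i" for i
      by (simp add: inner_vec_def matrix_vector_mult_def[of Z] sum_distrib_left mult.assoc
          mult.left_commute mult.commute)
    then show ?thesis by (simp add: inner_vec_def)
  qed
  finally show ?thesis .
qed simp

text \<open>
  A semidefinite form that vanishes at \<open>v\<close> is minimal there, so its gradient \<open>2 * (S *v v)\<close> vanishes too.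
  The proof moves from \<open>v\<close> a short way along \<open>- S *v v\<close>.
\<close>

lemma psd_kernel:
  fixes S :: "real^'r^'r"
  assumes sym: "transpose S = S" and psd: "\<And>w. w \<bullet> (S *v w) \<ge> 0" and v: "v \<bullet> (S *v v) = 0"
  shows "S *v v = 0"
proof (rule ccontr)
  let ?w = "S *v v"
  assume "?w \<noteq> 0"
  then have p: "?w \<bullet> ?w > 0" by simp
  define c where "c = ?w \<bullet> (S *v ?w)"
  have c: "c \<ge> 0" using psd by (simp add: c_def)
  have "v \<bullet> (S *v ?w) = ?w \<bullet> ?w"
    by (metis dot_lmul_matrix sym transpose_matrix_vector)
  then have q: "(v + t *\<^sub>R ?w) \<bullet> (S *v (v + t *\<^sub>R ?w)) = 2 * t * (?w \<bullet> ?w) + t\<^sup>2 * c" for t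
    by (simp add: matrix_vector_right_distrib matrix_vector_mult_scaleR inner_add_left
        inner_add_right v c_def power2_eq_square algebra_simps)
  have nonneg: "0 \<le> 2 * t * (?w \<bullet> ?w) + t\<^sup>2 * c" for t
    using psd[of "v + t *\<^sub>R ?w"] unfolding q .
  define t where "t = - (?w \<bullet> ?w) / (c + 1)"
  have "t < 0" and "- (?w \<bullet> ?w) \<le> t * c"
    using p c by (simp_all add: t_def field_simps)
  moreover have "0 \<le> t * (2 * (?w \<bullet> ?w) + t * c)"
    using nonneg[of t] by (simp add: power2_eq_square algebra_simps)
  ultimately show False
    using p by (simp add: zero_le_mult_iff)
qed

text \<open>
  Existence of the polar decomposition, without spectral theory: a maximiser \<open>Y\<close> of the pairing with
  \<open>Z\<close> exists by compactness, and the two optimality conditions make \<open>S = Z\<^sup>T Y\<close> a symmetric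
  semidefinite matrix with \<open>Z = Y ** S\<close>.  Full column rank excludes a kernel of \<open>S\<close>.
\<close>

lemma polar_decomposition:
  fixes Z :: "real^'r^'n"
  assumes Z: "full_column_rank Z" and ne: "(Stiefel :: (real^'r^'n) set) \<noteq> {}"
  obtains Y S where "Y \<in> Stiefel" "posdef_matrix S" "Z = Y ** S"
proof -
  obtain Y :: "real^'r^'n" where Y: "Y \<in> Stiefel" and max: "\<And>W. W \<in> Stiefel \<Longrightarrow> W \<bullet> Z \<le> Y \<bullet> Z"
  proof -
    have "continuous_on (Stiefel :: (real^'r^'n) set) (\<lambda>W. W \<bullet> Z)"
      by (intro continuous_intros)
    from continuous_attains_sup[OF compact_Stiefel ne this] show ?thesis
      using that by blast
  qed
  define S where "S = transpose Z ** Y"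
  have comm: "Z ** transpose Y = Y ** transpose Z"
    using Stiefel_max_symmetric[OF Y max]
    by (simp add: vec_eq_iff matrix_matrix_mult_def transpose_def inner_vec_def mult.commute)
  have ZYS: "Z = Y ** S"
    by (metis S_def Stiefel_D[OF Y] comm matrix_mul_assoc matrix_mul_rid)
  then have YZ: "transpose Y ** Z = S"
    by (simp add: Stiefel_mult_cancel[OF Y])
  have sym: "transpose S = S"
    using YZ by (metis S_def matrix_transpose_mul transpose_transpose)
  have form: "v \<bullet> (S *v v) = (Y *v v) \<bullet> (Z *v v)" for v
    unfolding YZ[symmetric] matrix_vector_mul_assoc[symmetric]
    by (metis dot_lmul_matrix transpose_matrix_vector transpose_transpose)
  have psd: "v \<bullet> (S *v v) \<ge> 0" for v
    unfolding form using Stiefel_max_semidefinite[OF Y max] .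
  have "v \<bullet> (S *v v) > 0" if "v \<noteq> 0" for v
  proof (rule ccontr)
    assume "\<not> v \<bullet> (S *v v) > 0"
    then have "S *v v = 0"
      using psd_kernel[OF sym psd] psd[of v] by (metis antisym not_less)
    then have "Z *v v = 0"
      unfolding ZYS by (simp add: matrix_vector_mul_assoc[symmetric])
    then show False using Z that by (auto simp: full_column_rank_def)
  qed
  then have "posdef_matrix S" by (simp add: posdef_matrix_def sym)
  with Y ZYS that show ?thesis by blast
qed

lemma posdef_invertible:
  fixes S :: "real^'r^'r"
  assumes "posdef_matrix S"
  shows "S ** matrix_inv S = mat 1" "matrix_inv S ** S = mat 1"
proof -
  have "S *v v = 0 \<Longrightarrow> v = 0" for v
    using assms by (auto simp: posdef_matrix_def)
  then have "invertible S"
    using matrix_left_invertible_ker[of S] by (simp add: invertible_left_inverse)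
  then have "S ** matrix_inv S = mat 1 \<and> matrix_inv S ** S = mat 1"
    unfolding invertible_def matrix_inv_def by (rule someI_ex)
  then show "S ** matrix_inv S = mat 1" "matrix_inv S ** S = mat 1" by simp_all
qed

lemma polar_decomposition_unique:
  fixes Y W :: "real^'r^'n"
  assumes Y: "Y \<in> Stiefel" "posdef_matrix S" and W: "W \<in> Stiefel" "posdef_matrix R"
    and eq: "Y ** S = W ** R"
  shows "W = Y" "R = S"
proof -
  show "W = Y"
    using polar_factor_strict_max[OF Y(1) W(1) Y(2)] polar_factor_strict_max[OF W(1) Y(1) W(2)]
    unfolding eq by fastforce
  then show "R = S"
    using eq Stiefel_mult_cancel[OF Y(1)] by metis
qed

text \<open>
  The square root in the retraction is described by uniqueness.  It is unique because any positive
  definite root \<open>R\<close> of the Gram matrix of \<open>Y ** S\<close> yields another polar decomposition of \<open>Y ** S\<close>, with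
  factor \<open>W = Y ** S ** matrix_inv R\<close>.
\<close>

lemma matrix_sqrt_gram:
  fixes Y :: "real^'r^'n"
  assumes Y: "Y \<in> Stiefel" and S: "posdef_matrix S"
  shows "matrix_sqrt (transpose (Y ** S) ** (Y ** S)) = S"
proof -
  have sym: "transpose S = S" using S by (simp add: posdef_matrix_def)
  have gram: "transpose (Y ** S) ** (Y ** S) = S ** S"
    unfolding matrix_transpose_mul sym matrix_mul_assoc[symmetric] Stiefel_mult_cancel[OF Y] ..
  show ?thesis
    unfolding gram matrix_sqrt_def
  proof (rule the_equality)
    show "posdef_matrix S \<and> S ** S = S ** S" using S by simp
    fix R assume R: "posdef_matrix R \<and> R ** R = S ** S"
    then have R1: "posdef_matrix R" and R2: "R ** R = S ** S" and Rs: "transpose R = R"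
      by (auto simp: posdef_matrix_def)
    define W where "W = (Y ** S) ** matrix_inv R"
    have WR: "W ** R = Y ** S"
      unfolding W_def matrix_mul_assoc[symmetric] posdef_invertible(2)[OF R1] by simp
    have "R ** (transpose W ** W) ** R = transpose (W ** R) ** (W ** R)"
      by (simp add: matrix_transpose_mul Rs matrix_mul_assoc)
    also have "\<dots> = R ** R"
      unfolding WR gram R2 ..
    finally have e: "R ** (transpose W ** W) ** R = R ** R" .
    have "transpose W ** W = matrix_inv R ** (R ** (transpose W ** W) ** R) ** matrix_inv R"
      unfolding matrix_mul_assoc posdef_invertible(2)[OF R1]
      unfolding matrix_mul_assoc[symmetric] posdef_invertible(1)[OF R1] by simp
    also have "\<dots> = mat 1"
      unfolding e unfolding matrix_mul_assoc posdef_invertible(2)[OF R1]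
      unfolding matrix_mul_assoc[symmetric] posdef_invertible(1)[OF R1] by simp
    finally have "W \<in> Stiefel" by (simp add: Stiefel_def)
    from polar_decomposition_unique(2)[OF Y S this R1 WR[symmetric]]
    show "R = S" .
  qed
qed

text \<open>
  The polar retraction depends on \<open>X\<close> and \<open>\<xi>\<close> only through \<open>X + \<xi>\<close>; as a function of this one
  matrix it can be studied by the maximisation characterisation.
\<close>

definition polar_factor :: "real^'r^'n \<Rightarrow> real^'r^'n" where
  "polar_factor Z = Z ** matrix_inv (matrix_sqrt (transpose Z ** Z))"

lemma polar_factor_mult:
  fixes Y :: "real^'r^'n"
  assumes Y: "Y \<in> Stiefel" and S: "posdef_matrix S"
  shows "polar_factor (Y ** S) = Y"
  unfolding polar_factor_def matrix_sqrt_gram[OF Y S]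
  unfolding matrix_mul_assoc[symmetric] posdef_invertible(1)[OF S] by simp

text \<open>
  A unique maximiser over a compact set depends continuously on the objective: the relation
  that \<open>W\<close> maximises the pairing with \<open>Z\<close> is closed, it is the graph of the polar factor, and a map into a
  compact set with closed graph is continuous.
\<close>

lemma continuous_on_polar_factor:
  assumes ne: "(Stiefel :: (real^'r^'n) set) \<noteq> {}"
  shows "continuous_on {Z. full_column_rank Z} (polar_factor :: real^'r^'n \<Rightarrow> real^'r^'n)"
proof -
  let ?F = "{Z :: real^'r^'n. full_column_rank Z}"
  let ?K = "{p :: (real^'r^'n) \<times> (real^'r^'n). \<forall>W\<in>Stiefel. W \<bullet> fst p \<le> snd p \<bullet> fst p}"
  have "closed ?K"
    unfolding Collect_ball_eq
    by (intro closed_INT ballI closed_Collect_le continuous_intros)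
  moreover have "(\<lambda>Z. (Z, polar_factor Z)) ` ?F = (?F \<times> Stiefel) \<inter> ?K"
  proof (intro equalityI subsetI)
    fix p assume "p \<in> (\<lambda>Z. (Z, polar_factor Z)) ` ?F"
    then obtain Z where Z: "full_column_rank Z" and p: "p = (Z, polar_factor Z)" by auto
    obtain Y S where Y: "Y \<in> Stiefel" "posdef_matrix S" and ZY: "Z = Y ** S"
      using polar_decomposition[OF Z ne] .
    have "W \<bullet> Z \<le> Y \<bullet> Z" if "W \<in> Stiefel" for W
      using polar_factor_strict_max[OF Y(1) that Y(2)] unfolding ZY by (cases "W = Y") auto
    then show "p \<in> (?F \<times> Stiefel) \<inter> ?K"
      using Z Y by (simp add: p ZY polar_factor_mult)
  next
    fix p assume "p \<in> (?F \<times> Stiefel) \<inter> ?K"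
    then obtain Z W where p: "p = (Z, W)" and Z: "full_column_rank Z" and W: "W \<in> Stiefel"
      and max: "\<And>V. V \<in> Stiefel \<Longrightarrow> V \<bullet> Z \<le> W \<bullet> Z"
      by (cases p) auto
    obtain Y S where Y: "Y \<in> Stiefel" "posdef_matrix S" and ZY: "Z = Y ** S"
      using polar_decomposition[OF Z ne] .
    have "W = Y"
      using polar_factor_strict_max[OF Y(1) W Y(2)] max[OF Y(1)] unfolding ZY by fastforce
    then have "W = polar_factor Z"
      using Y by (simp add: ZY polar_factor_mult)
    with Z p show "p \<in> (\<lambda>Z. (Z, polar_factor Z)) ` ?F" by simp
  qed
  moreover have "polar_factor \<in> ?F \<rightarrow> Stiefel"
  proof
    fix Z :: "real^'r^'n" assume "Z \<in> ?F"
    then have "full_column_rank Z" by simp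
    then obtain Y S where "Y \<in> Stiefel" "posdef_matrix S" "Z = Y ** S"
      using polar_decomposition ne by metis
    then show "polar_factor Z \<in> Stiefel" by (simp add: polar_factor_mult)
  qed
  ultimately show ?thesis
    using continuous_closed_graph_eq[OF compact_Stiefel, of polar_factor ?F]
    by (simp add: closedin_closed_Int)
qed

section \<open>Tangent steps and the polar retraction\<close>

definition Stiefel_tangent :: "real^'r^'n \<Rightarrow> (real^'r^'n) set" where
  "Stiefel_tangent X = {\<xi>. transpose \<xi> ** X + transpose X ** \<xi> = 0}"

lemma tangent_proj_tangent:
  fixes X B :: "real^'r^'n"
  assumes X: "X \<in> Stiefel"
  shows "tangent_proj X B \<in> Stiefel_tangent X"
proof -
  define H where "H = transpose B ** X + transpose X ** B"
  have H: "transpose H = H"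
    by (simp add: H_def transpose_linear_simps matrix_transpose_mul add.commute)
  have "transpose X ** tangent_proj X B = transpose X ** B - (1/2) *\<^sub>R H"
    by (simp add: tangent_proj_def H_def[symmetric] matrix_mult_simps Stiefel_mult_cancel[OF X])
  moreover have "transpose (tangent_proj X B) ** X = transpose (transpose X ** tangent_proj X B)"
    by (simp add: matrix_transpose_mul)
  ultimately have "transpose (tangent_proj X B) ** X + transpose X ** tangent_proj X B
      = H - ((1/2) *\<^sub>R H + (1/2) *\<^sub>R H)"
    by (simp add: transpose_linear_simps H matrix_transpose_mul) (simp add: H_def)
  also have "\<dots> = 0"
    by (simp add: scaleR_left_distrib[symmetric])
  finally show ?thesis by (simp add: Stiefel_tangent_def)
qed

lemma Stiefel_tangent_scaleR:
  fixes X :: "real^'r^'n"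
  assumes "\<xi> \<in> Stiefel_tangent X"
  shows "c *\<^sub>R \<xi> \<in> Stiefel_tangent X"
proof -
  have "transpose (c *\<^sub>R \<xi>) ** X + transpose X ** (c *\<^sub>R \<xi>)
      = c *\<^sub>R (transpose \<xi> ** X + transpose X ** \<xi>)"
    by (simp add: transpose_linear_simps matrix_mult_simps scaleR_right_distrib)
  with assms show ?thesis by (simp add: Stiefel_tangent_def)
qed

lemma gram_tangent_step:
  fixes X \<xi> :: "real^'r^'n"
  assumes X: "X \<in> Stiefel" and \<xi>: "\<xi> \<in> Stiefel_tangent X"
  shows "transpose (X + \<xi>) ** (X + \<xi>) = mat 1 + transpose \<xi> ** \<xi>"
proof -
  have "transpose (X + \<xi>) ** (X + \<xi>)
      = mat 1 + transpose \<xi> ** \<xi> + (transpose \<xi> ** X + transpose X ** \<xi>)"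
    by (simp add: transpose_linear_simps matrix_mult_simps Stiefel_D[OF X])
  then show ?thesis using \<xi> by (simp add: Stiefel_tangent_def)
qed

lemma inner_gram: 
  fixes A :: "real^'r^'n"
  shows "v \<bullet> ((transpose A ** A) *v v) = (norm (A *v v))\<^sup>2"
  unfolding matrix_vector_mul_assoc[symmetric] power2_norm_eq_inner
  by (metis dot_lmul_matrix transpose_matrix_vector transpose_transpose)

lemma full_column_rank_tangent_step:
  fixes X \<xi> :: "real^'r^'n"
  assumes X: "X \<in> Stiefel" and \<xi>: "\<xi> \<in> Stiefel_tangent X"
  shows "full_column_rank (X + \<xi>)"
  unfolding full_column_rank_def
proof (intro allI impI notI)
  fix v :: "real^'r" assume v: "v \<noteq> 0" "(X + \<xi>) *v v = 0"
  have "(norm ((X + \<xi>) *v v))\<^sup>2 = v \<bullet> ((transpose (X + \<xi>) ** (X + \<xi>)) *v v)"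
    by (rule inner_gram[symmetric])
  also have "\<dots> = (norm v)\<^sup>2 + (norm (\<xi> *v v))\<^sup>2"
    unfolding gram_tangent_step[OF X \<xi>] inner_gram[of v \<xi>, symmetric]
    by (simp add: matrix_vector_mult_add_rdistrib inner_add_right power2_norm_eq_inner)
  finally have "(norm v)\<^sup>2 + (norm (\<xi> *v v))\<^sup>2 = 0"
    using v by simp
  then show False using v by (simp add: sum_power2_eq_zero_iff)
qed

lemma polar_retr_eq_polar_factor:
  assumes "X \<in> Stiefel" "\<xi> \<in> Stiefel_tangent X"
  shows "polar_retr X \<xi> = polar_factor (X + \<xi>)"
  unfolding polar_retr_def polar_factor_def gram_tangent_step[OF assms] ..

lemma polar_retr_decomposition:
  fixes X \<xi> :: "real^'r^'n"
  assumes X: "X \<in> Stiefel" and \<xi>: "\<xi> \<in> Stiefel_tangent X"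
  obtains S where "posdef_matrix S" "X + \<xi> = polar_retr X \<xi> ** S" "polar_retr X \<xi> \<in> Stiefel"
proof -
  have ne: "(Stiefel :: (real^'r^'n) set) \<noteq> {}" using X by auto
  obtain Y S where "Y \<in> Stiefel" "posdef_matrix S" "X + \<xi> = Y ** S"
    using polar_decomposition[OF full_column_rank_tangent_step[OF X \<xi>] ne] .
  with that show ?thesis
    by (simp add: polar_retr_eq_polar_factor[OF X \<xi>] polar_factor_mult)
qed

lemma polar_retr_Stiefel:
  assumes "X \<in> Stiefel" "\<xi> \<in> Stiefel_tangent X"
  shows "polar_retr X \<xi> \<in> Stiefel"
  using polar_retr_decomposition[OF assms] by blast

text \<open>
  If \<open>S\<^sup>2\<close> dominates the identity, so does \<open>S\<close>.  The solution \<open>u\<close> of \<open>S *v u = v\<close> is no longer than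
  \<open>v\<close>, and the claim follows from the nonnegativity of the form of \<open>S\<close> at \<open>v - u\<close>.
\<close>

lemma sqrt_ge_identity:
  fixes S :: "real^'r^'r"
  assumes S: "posdef_matrix S" and grow: "\<And>v. norm v \<le> norm (S *v v)"
  shows "v \<bullet> v \<le> v \<bullet> (S *v v)"
proof -
  have sym: "transpose S = S" and psd: "w \<bullet> (S *v w) \<ge> 0" for w
    using S by (auto simp: posdef_matrix_def) (cases "w = 0"; force)
  define u where "u = matrix_inv S *v v"
  have Su: "S *v u = v"
    by (simp add: u_def matrix_vector_mul_assoc posdef_invertible[OF S])
  have uSv: "u \<bullet> (S *v v) = v \<bullet> v"
    by (metis Su dot_lmul_matrix sym transpose_matrix_vector)
  have "u \<bullet> v \<le> norm u * norm v"
    by (rule norm_cauchy_schwarz)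
  also have "\<dots> \<le> norm v * norm v"
    using grow[of u] by (simp add: Su mult_right_mono)
  finally have "u \<bullet> v \<le> v \<bullet> v"
    by (simp add: power2_norm_eq_inner[symmetric] power2_eq_square)
  moreover have "0 \<le> (v - u) \<bullet> (S *v (v - u))"
    by (rule psd)
  ultimately show ?thesis
    by (simp add: matrix_vector_mult_diff_distrib inner_diff_left inner_diff_right Su uSv)
qed

text \<open>
  The nearest-point projection onto a nonconvex set need not be nonexpansive.  Here it moves no point
  of the manifold farther away, because a tangent step has Gram matrix \<open>mat 1 + \<xi>\<^sup>T \<xi>\<close>: its symmetric polar
  part \<open>S\<close> satisfies \<open>S \<ge> mat 1\<close>, so the residual \<open>Y ** (S - mat 1)\<close> is a normal vector that points outwards, and
  its pairing with every chord \<open>W - Y\<close> is nonpositive.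
\<close>

lemma polar_retr_nonexpansive:
  fixes X \<xi> W :: "real^'r^'n"
  assumes X: "X \<in> Stiefel" and \<xi>: "\<xi> \<in> Stiefel_tangent X" and W: "W \<in> Stiefel"
  shows "norm (W - polar_retr X \<xi>) \<le> norm (W - (X + \<xi>))"
proof -
  obtain S where S: "posdef_matrix S" and Z: "X + \<xi> = polar_retr X \<xi> ** S"
    and Y: "polar_retr X \<xi> \<in> Stiefel"
    using polar_retr_decomposition[OF X \<xi>] .
  define Y where "Y = polar_retr X \<xi>"
  note Y = Y[folded Y_def] and Z = Z[folded Y_def]
  have sym: "transpose S = S" using S by (simp add: posdef_matrix_def)
  have grow: "norm v \<le> norm (S *v v)" for v
  proof -
    have "transpose S ** S = mat 1 + transpose \<xi> ** \<xi>"
      unfolding gram_tangent_step[OF X \<xi>, symmetric] Z matrix_transpose_mul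
        matrix_mul_assoc[symmetric] Stiefel_mult_cancel[OF Y] ..
    then have "(norm (S *v v))\<^sup>2 = (norm v)\<^sup>2 + (norm (\<xi> *v v))\<^sup>2"
      unfolding inner_gram[symmetric]
      by (simp add: matrix_vector_mult_add_rdistrib inner_add_right power2_norm_eq_inner)
    then show ?thesis by - (rule power2_le_imp_le, auto)
  qed
  define K where "K = S - mat 1"
  have K: "transpose K = K" by (simp add: K_def transpose_linear_simps sym)
  have psd: "0 \<le> v \<bullet> (K *v v)" for v
    using sqrt_ge_identity[OF S grow, of v]
    by (simp add: K_def matrix_vector_mult_diff_rdistrib inner_diff_right)
  let ?D = "W - Y"
  have "(?D ** K) \<bullet> ?D = (\<Sum>i\<in>UNIV. (?D $ i) \<bullet> (K *v (?D $ i)))"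
    by (rule inner_mult_rows[OF K])
  also have "\<dots> \<ge> 0"
    by (intro sum_nonneg psd)
  finally have "(Y ** K) \<bullet> ?D \<le> 0"
    by (simp add: inner_Stiefel_diff[OF Y W K])
  moreover have resid: "W - (X + \<xi>) = ?D - Y ** K"
    by (simp add: Z K_def matrix_mult_simps)
  moreover have "(norm (?D - Y ** K))\<^sup>2 = (norm ?D)\<^sup>2 - 2 * ((Y ** K) \<bullet> ?D) + (norm (Y ** K))\<^sup>2"
    using dot_norm_neg[of ?D "Y ** K"] by (simp add: inner_commute)
  ultimately have "(norm ?D)\<^sup>2 \<le> (norm (W - (X + \<xi>)))\<^sup>2"
    unfolding resid using zero_le_power2[of "norm (Y ** K)"] by linarith
  then show ?thesis
    unfolding Y_def by (rule power2_le_imp_le) simp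
qed

section \<open>The tangent projection\<close>

text \<open>
  The tangent projection is orthogonal: what it removes is the normal vector \<open>X ** S\<close>, where \<open>S\<close> is the
  symmetric part of \<open>X\<^sup>T B\<close>, and \<open>X ** S\<close> has the norm of \<open>S\<close>.
\<close>

lemma tangent_proj_decomposition:
  fixes X B :: "real^'r^'n"
  assumes X: "X \<in> Stiefel"
  obtains S where "transpose S = S" "B = tangent_proj X B + X ** S"
    "(norm B)\<^sup>2 = (norm (tangent_proj X B))\<^sup>2 + (norm S)\<^sup>2"
proof -
  define S where "S = (1/2) *\<^sub>R (transpose B ** X + transpose X ** B)"
  have sym: "transpose S = S"
    by (simp add: S_def transpose_linear_simps matrix_transpose_mul add.commute)
  have dec: "B = tangent_proj X B + X ** S"
    by (simp add: S_def tangent_proj_def matrix_mult_simps)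
  let ?T = "tangent_proj X B"
  have "(X ** S) \<bullet> ?T = S \<bullet> (transpose X ** ?T)"
    by (rule inner_mult_left)
  also have "\<dots> = 0"
  proof -
    have "S \<bullet> (transpose X ** ?T) = S \<bullet> (transpose ?T ** X)"
      using inner_transpose[of S "transpose X ** ?T"] by (simp add: sym matrix_transpose_mul)
    moreover have "S \<bullet> (transpose ?T ** X + transpose X ** ?T) = 0"
      using tangent_proj_tangent[OF X] by (simp add: Stiefel_tangent_def)
    ultimately show ?thesis by (simp add: inner_add_right)
  qed
  finally have orth: "(X ** S) \<bullet> ?T = 0" .
  have "(norm (X ** S))\<^sup>2 = (norm S)\<^sup>2"
    by (simp add: power2_norm_eq_inner inner_mult_left Stiefel_mult_cancel[OF X])
  then have "(norm B)\<^sup>2 = (norm ?T)\<^sup>2 + (norm S)\<^sup>2"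
    using orth inner_commute[of ?T "X ** S"]
    by (subst dec) (simp add: power2_norm_eq_inner inner_add_left inner_add_right)
  with sym dec that show ?thesis by blast
qed

lemma norm_tangent_proj_le:
  fixes X B :: "real^'r^'n"
  assumes "X \<in> Stiefel"
  shows "norm (tangent_proj X B) \<le> norm B"
proof -
  obtain S :: "real^'r^'r" where "(norm B)\<^sup>2 = (norm (tangent_proj X B))\<^sup>2 + (norm S)\<^sup>2"
    using tangent_proj_decomposition[OF assms] by metis
  then show ?thesis by - (rule power2_le_imp_le, auto)
qed

text \<open>
  The normal part \<open>X ** S\<close> of \<open>B\<close> pairs with the chord only to second order, with a factor at most
  \<open>norm S \<le> norm B\<close>.  This is the source of the constant \<open>L\<close> in the modulus \<open>L + \<tau>\<close>.
\<close>

lemma tangent_proj_inner_error: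
  fixes X Y B :: "real^'r^'n"
  assumes X: "X \<in> Stiefel" and Y: "Y \<in> Stiefel"
  shows "tangent_proj X B \<bullet> (Y - X) \<le> B \<bullet> (Y - X) + norm B / 2 * (norm (Y - X))\<^sup>2"
proof -
  obtain S where S: "transpose S = S" "B = tangent_proj X B + X ** S"
    "(norm B)\<^sup>2 = (norm (tangent_proj X B))\<^sup>2 + (norm S)\<^sup>2"
    using tangent_proj_decomposition[OF X] .
  let ?D = "Y - X"
  have SB: "norm S \<le> norm B"
    using S(3) by - (rule power2_le_imp_le, auto)
  have "(?D ** S) \<bullet> ?D \<le> norm (?D ** S) * norm ?D"
    by (rule norm_cauchy_schwarz)
  also have "\<dots> \<le> (norm ?D * norm B) * norm ?D"
    using norm_matrix_mult_le[of ?D S] mult_left_mono[OF SB norm_ge_zero[of ?D]]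
    by (intro mult_right_mono) auto
  finally have "(?D ** S) \<bullet> ?D \<le> norm B * (norm ?D)\<^sup>2"
    by (simp add: power2_eq_square mult_ac)
  moreover have "B \<bullet> ?D = tangent_proj X B \<bullet> ?D - (1/2) * ((?D ** S) \<bullet> ?D)"
    by (subst S(2)) (simp add: inner_add_left inner_Stiefel_diff[OF X Y S(1)])
  ultimately show ?thesis by simp
qed

section \<open>Subgradients of weakly convex functions on the manifold\<close>

lemma subdiff_inequality:
  assumes "V \<in> subdiff \<tau> h X"
  shows "h X + V \<bullet> (Y - X) - \<tau> / 2 * (norm (Y - X))\<^sup>2 \<le> h Y"
proof -
  from assms obtain W where V: "V = W - \<tau> *\<^sub>R X"
    and W: "h X + \<tau> / 2 * (norm X)\<^sup>2 + W \<bullet> (Y - X) \<le> h Y + \<tau> / 2 * (norm Y)\<^sup>2"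
    by (auto simp: subdiff_def convex_subdiff_def)
  have "V \<bullet> (Y - X) = W \<bullet> (Y - X) - \<tau> * (X \<bullet> (Y - X))"
    by (simp add: V inner_diff_left)
  moreover have "(norm (Y - X))\<^sup>2 = (norm Y)\<^sup>2 - 2 * (X \<bullet> (Y - X)) - (norm X)\<^sup>2"
    by (simp add: power2_norm_eq_inner inner_diff_left inner_diff_right inner_commute)
  then have "\<tau> / 2 * (norm (Y - X))\<^sup>2
      = \<tau> / 2 * (norm Y)\<^sup>2 - \<tau> * (X \<bullet> (Y - X)) - \<tau> / 2 * (norm X)\<^sup>2"
    by (simp only:) (simp add: algebra_simps)
  ultimately show ?thesis
    using W by linarith
qed

text \<open>
  Moving from \<open>X\<close> by \<open>t *\<^sub>R V\<close> raises \<open>h\<close> by at least \<open>t * (norm V)\<^sup>2\<close> up to a term of order \<open>t\<^sup>2\<close>, and by at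
  most \<open>K * t * norm V\<close>; the bound follows as \<open>t\<close> tends to 0.
\<close>

lemma norm_subdiff_le:
  assumes U: "open U" "X \<in> U" and lip: "K-lipschitz_on U h" and V: "V \<in> subdiff \<tau> h X"
  shows "norm V \<le> K"
proof (cases "V = 0")
  case True
  then show ?thesis using lipschitz_on_nonneg[OF lip] by simp
next
  case False
  then have nV: "norm V > 0" by simp
  obtain e where e: "e > 0" "ball X e \<subseteq> U"
    using U open_contains_ball by blast
  have "norm V * (1 - \<tau> * t / 2) \<le> K" if t: "0 < t" "t < e / norm V" for t
  proof -
    have "t * norm V < e"
      using t nV by (simp add: field_simps)
    then have "X + t *\<^sub>R V \<in> U"
      using e t by (auto simp: dist_norm subset_iff)
    then have "h (X + t *\<^sub>R V) - h X \<le> K * (t * norm V)"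
      using lipschitz_onD[OF lip _ U(2)] t by (fastforce simp: dist_norm)
    moreover have "h X + t * (norm V)\<^sup>2 - \<tau> / 2 * (t * norm V)\<^sup>2 \<le> h (X + t *\<^sub>R V)"
      using subdiff_inequality[OF V, of "X + t *\<^sub>R V"] t by (simp add: power2_norm_eq_inner)
    ultimately have "(t * norm V) * (norm V * (1 - \<tau> * t / 2)) \<le> (t * norm V) * K"
      by (simp add: power2_eq_square algebra_simps)
    then show ?thesis
      using t nV by simp
  qed
  then have "eventually (\<lambda>t. norm V * (1 - \<tau> * t / 2) \<le> K) (at_right 0)"
    using e nV by (auto simp: eventually_at_right_field intro!: exI[of _ "e / norm V"])
  moreover have "((\<lambda>t. norm V * (1 - \<tau> * t / 2)) \<longlongrightarrow> norm V * (1 - \<tau> * 0 / 2)) (at_right 0)"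
    by (intro tendsto_intros) simp
  ultimately have "norm V * (1 - \<tau> * 0 / 2) \<le> K"
    by (intro tendsto_upperbound) auto
  then show ?thesis by simp
qed

text \<open>
  Restricted to the manifold, \<open>f\<close> behaves like an \<open>(L + \<tau>)\<close>-weakly convex function whose subgradients are
  the projected ones: \<open>\<tau>\<close> comes from the Euclidean inequality, \<open>L\<close> from the discarded normal part.
\<close>

lemma riemannian_subgradient_inequality:
  fixes X Y V :: "real^'r^'n"
  assumes X: "X \<in> Stiefel" and Y: "Y \<in> Stiefel" and V: "V \<in> subdiff \<tau> f X" and L: "norm V \<le> L"
  shows "tangent_proj X V \<bullet> (Y - X) \<le> f Y - f X + (L + \<tau>) / 2 * (norm (Y - X))\<^sup>2"
proof -
  have "tangent_proj X V \<bullet> (Y - X) \<le> V \<bullet> (Y - X) + norm V / 2 * (norm (Y - X))\<^sup>2"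
    by (rule tangent_proj_inner_error[OF X Y])
  also have "norm V / 2 * (norm (Y - X))\<^sup>2 \<le> L / 2 * (norm (Y - X))\<^sup>2"
    using L by (intro mult_right_mono) auto
  also have "V \<bullet> (Y - X) \<le> f Y - f X + \<tau> / 2 * (norm (Y - X))\<^sup>2"
    using subdiff_inequality[OF V, of Y] by simp
  finally show ?thesis
    by (simp add: algebra_simps add_divide_distrib)
qed

section \<open>The Moreau envelope on the manifold\<close>

lemma prox_selection:
  fixes X :: "real^'r^'n"
  assumes P: "is_prox_selection lam f P" and X: "X \<in> Stiefel"
  shows prox_in_Stiefel: "P X \<in> Stiefel"
    and moreau_env_eq_prox: "moreau_env lam f X = f (P X) + 1 / (2 * lam) * (norm (P X - X))\<^sup>2"
    and moreau_env_le: "\<And>Y. Y \<in> Stiefel \<Longrightarrow> moreau_env lam f X \<le> f Y + 1 / (2 * lam) * (norm (Y - X))\<^sup>2"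
proof -
  have arg: "is_arg_min (prox_objective lam f X) (\<lambda>Y. Y \<in> Stiefel) (P X)"
    using P X by (simp add: is_prox_selection_def)
  then show PX: "P X \<in> Stiefel" by (simp add: is_arg_min_def)
  have min: "prox_objective lam f X (P X) \<le> prox_objective lam f X Y" if "Y \<in> Stiefel" for Y
    using arg that by (simp add: is_arg_min_linorder)
  have "moreau_env lam f X = prox_objective lam f X (P X)"
    unfolding moreau_env_def by (rule cInf_eq_minimum) (use PX min in auto)
  then show "moreau_env lam f X = f (P X) + 1 / (2 * lam) * (norm (P X - X))\<^sup>2"
    and "\<And>Y. Y \<in> Stiefel \<Longrightarrow> moreau_env lam f X \<le> f Y + 1 / (2 * lam) * (norm (Y - X))\<^sup>2"
    using min by (simp_all add: prox_objective_def)
qed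

text \<open>
  The proximal point of \<open>Y\<close> competes in the problem at \<open>X\<close>, so the envelope varies no more than
  \<open>1 / (2 * lam)\<close> times the squared distance to a fixed point of the manifold.  That variation is controlled because all points
  have the same norm \<open>R\<close>.  The envelope is thus bounded and Borel on the manifold.
\<close>

lemma moreau_env_lipschitz:
  fixes P :: "real^'r^'n \<Rightarrow> real^'r^'n"
  assumes P: "is_prox_selection lam f P" and lam: "lam > 0"
  shows "(2 * sqrt (real CARD('r)) / lam)-lipschitz_on Stiefel (moreau_env lam f :: real^'r^'n \<Rightarrow> real)"
proof -
  define R where "R = sqrt (real CARD('r))"
  have R: "norm X = R" if "X \<in> Stiefel" for X :: "real^'r^'n"
    using norm_Stiefel[OF that] by (metis R_def norm_ge_zero real_sqrt_unique)
  have *: "moreau_env lam f X - moreau_env lam f Y \<le> 2 * R / lam * norm (X - Y)"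
    if X: "X \<in> Stiefel" and Y: "Y \<in> Stiefel" for X Y :: "real^'r^'n"
  proof -
    define a b where "a = norm (P Y - X)" and "b = norm (P Y - Y)"
    have PY: "P Y \<in> Stiefel" by (rule prox_in_Stiefel[OF P Y])
    have "a - b \<le> norm (X - Y)"
      unfolding a_def b_def using norm_triangle_ineq2[of "P Y - X" "P Y - Y"]
      by (simp add: norm_minus_commute)
    moreover have "a + b \<le> 4 * R"
      unfolding a_def b_def using norm_triangle_ineq4[of "P Y" X] norm_triangle_ineq4[of "P Y" Y]
      by (simp add: R[OF X] R[OF Y] R[OF PY])
    ultimately have "(a - b) * (a + b) \<le> norm (X - Y) * (4 * R)"
      by (intro mult_mono) (auto simp: a_def b_def)
    moreover have "moreau_env lam f X - moreau_env lam f Y \<le> 1 / (2 * lam) * ((a - b) * (a + b))"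
      using moreau_env_le[OF P X PY] unfolding moreau_env_eq_prox[OF P Y] a_def[symmetric] b_def[symmetric]
      by (simp add: power2_eq_square algebra_simps diff_divide_distrib)
    ultimately have "moreau_env lam f X - moreau_env lam f Y \<le> 1 / (2 * lam) * (norm (X - Y) * (4 * R))"
      using lam by (elim order_trans) (intro mult_left_mono, auto)
    then show ?thesis by (simp add: mult_ac)
  qed
  show ?thesis
    unfolding R_def[symmetric]
  proof (rule lipschitz_onI)
    fix X Y :: "real^'r^'n" assume "X \<in> Stiefel" "Y \<in> Stiefel"
    then show "dist (moreau_env lam f X) (moreau_env lam f Y) \<le> 2 * R / lam * dist X Y"
      using *[of X Y] *[of Y X] by (simp add: dist_real_def dist_norm norm_minus_commute abs_le_iff)
  qed (use lam in \<open>simp add: R_def\<close>)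
qed

section \<open>One step of the method as a measurable map\<close>

abbreviation Stiefel_borel :: "(real^'r^'n) measure" where
  "Stiefel_borel \<equiv> restrict_space borel Stiefel"

definition rssm_step ::
  "(real^'r^'n \<Rightarrow> 'z \<Rightarrow> real^'r^'n) \<Rightarrow> real \<Rightarrow> real^'r^'n \<Rightarrow> 'z \<Rightarrow> real^'r^'n" where
  "rssm_step G c X z = polar_retr X (- (c *\<^sub>R riem_stoch_subgrad G X z))"

lemma rssm_step_direction_tangent:
  assumes "X \<in> Stiefel"
  shows "- (c *\<^sub>R riem_stoch_subgrad G X z) \<in> Stiefel_tangent X"
  using Stiefel_tangent_scaleR[OF tangent_proj_tangent[OF assms], of "- c"]
  by (simp add: riem_stoch_subgrad_def)

lemma rssm_step_Stiefel: "X \<in> Stiefel \<Longrightarrow> rssm_step G c X z \<in> Stiefel"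
  unfolding rssm_step_def by (intro polar_retr_Stiefel rssm_step_direction_tangent)

text \<open>
  The step is the continuous polar factor applied to the point reached along the tangent direction;
  that point has full column rank, so the iterates stay in the domain of continuity.
\<close>

lemma rssm_step_measurable:
  fixes G :: "real^'r^'n \<Rightarrow> 'z \<Rightarrow> real^'r^'n"
  assumes G: "(\<lambda>(X, z). G X z) \<in> borel_measurable (Stiefel_borel \<Otimes>\<^sub>M D)"
    and ne: "(Stiefel :: (real^'r^'n) set) \<noteq> {}"
  shows "(\<lambda>(X, z). rssm_step G c X z) \<in> Stiefel_borel \<Otimes>\<^sub>M D \<rightarrow>\<^sub>M Stiefel_borel"
proof -
  let ?N = "Stiefel_borel \<Otimes>\<^sub>M D"
  let ?Z = "\<lambda>p. fst p - c *\<^sub>R tangent_proj (fst p) (G (fst p) (snd p))"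
  have G': "(\<lambda>p. G (fst p) (snd p)) \<in> borel_measurable ?N"
    using G by (simp add: case_prod_beta')
  have X: "fst \<in> borel_measurable ?N"
    by (rule measurable_compose[OF measurable_fst]) (simp add: measurable_restrict_space1)
  have cont: "continuous_on UNIV (\<lambda>q :: (real^'r^'n) \<times> (real^'r^'n).
      fst q - c *\<^sub>R tangent_proj (fst q) (snd q))"
    unfolding tangent_proj_def by (intro continuous_intros)
  have "?Z \<in> borel_measurable ?N"
    using borel_measurable_continuous_Pair[OF X G' cont] .
  moreover have rank: "full_column_rank (?Z p)" "rssm_step G c (fst p) (snd p) = polar_factor (?Z p)"
    if "p \<in> space ?N" for p
  proof -
    have "fst p \<in> Stiefel"
      using that by (auto simp: space_pair_measure space_restrict_space)
    note 1 = this rssm_step_direction_tangent[OF this, of c G "snd p"]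
    show "full_column_rank (?Z p)"
      using full_column_rank_tangent_step[OF 1] by (simp add: riem_stoch_subgrad_def)
    show "rssm_step G c (fst p) (snd p) = polar_factor (?Z p)"
      unfolding rssm_step_def polar_retr_eq_polar_factor[OF 1] by (simp add: riem_stoch_subgrad_def)
  qed
  ultimately have "?Z \<in> ?N \<rightarrow>\<^sub>M restrict_space borel {Z. full_column_rank Z}"
    by (intro measurable_restrict_space2) auto
  from measurable_compose[OF this borel_measurable_continuous_on_restrict[OF continuous_on_polar_factor[OF ne]]]
  have "(\<lambda>p. polar_factor (?Z p)) \<in> borel_measurable ?N" .
  then have "(\<lambda>p. rssm_step G c (fst p) (snd p)) \<in> borel_measurable ?N"
    by (subst measurable_cong[OF rank(2)])
  then show ?thesis
    unfolding case_prod_beta'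
    by (intro measurable_restrict_space2)
      (auto simp: space_pair_measure space_restrict_space intro!: rssm_step_Stiefel)
qed

section \<open>The one-step inequality\<close>

text \<open>
  The stepsize \<open>c\<close> and the choice \<open>P\<close> of proximal points are parameters here, so that the envelope, its
  expected value after a step, and the majorant below are functions of the iterate alone.
\<close>

locale stochastic_subgradient_problem = D: prob_space D
  for D :: "'z measure" +
  fixes g :: "real^'r^'n \<Rightarrow> 'z \<Rightarrow> real"
    and f :: "real^'r^'n \<Rightarrow> real"
    and \<tau> L lam c :: real
    and U :: "(real^'r^'n) set"
    and Lz :: "'z \<Rightarrow> real"
    and G :: "real^'r^'n \<Rightarrow> 'z \<Rightarrow> real^'r^'n"
    and P :: "real^'r^'n \<Rightarrow> real^'r^'n"
  assumes tau: "\<tau> \<ge> 0"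
    and f_eq: "\<And>Y. f Y = (LINT z|D. g Y z)"
    and U: "open U" "Stiefel \<subseteq> U"
    and lipschitz: "\<And>z. z \<in> space D \<Longrightarrow> (Lz z)-lipschitz_on U (\<lambda>Y. g Y z)"
    and Lz_square: "integrable D (\<lambda>z. (Lz z)\<^sup>2)"
    and L: "L > 0" "L\<^sup>2 = (LINT z|D. (Lz z)\<^sup>2)"
    and sampling: "stoch_subgrad_oracle D \<tau> g G"
    and lam: "0 < lam" "lam < 1 / (L + \<tau>)"
    and P: "is_prox_selection lam f P"
    and c_pos: "c > 0"
    and Stiefel_nonempty: "(Stiefel :: (real^'r^'n) set) \<noteq> {}"
begin

abbreviation env :: "real^'r^'n \<Rightarrow> real" where
  "env \<equiv> moreau_env lam f"

abbreviation step :: "real^'r^'n \<Rightarrow> 'z \<Rightarrow> real^'r^'n" where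
  "step \<equiv> rssm_step G c"

lemma curvature_gap: "1 / lam - (L + \<tau>) > 0"
  using lam L tau by (simp add: field_simps)

lemma norm_oracle_le:
  assumes "X \<in> Stiefel" "z \<in> space D"
  shows "norm (G X z) \<le> Lz z"
proof (rule norm_subdiff_le[OF U(1) _ lipschitz])
  show "X \<in> U" using assms U by blast
  show "G X z \<in> subdiff \<tau> (\<lambda>Y. g Y z) X"
    using sampling assms by (simp add: stoch_subgrad_oracle_def)
qed (rule assms)

lemma
  assumes "X \<in> Stiefel"
  shows oracle_integrable: "integrable D (G X)"
    and oracle_mean_subdiff: "(LINT z|D. G X z) \<in> subdiff \<tau> f X"
proof -
  have "f = (\<lambda>Y. LINT z|D. g Y z)" using f_eq by blast
  then show "integrable D (G X)" "(LINT z|D. G X z) \<in> subdiff \<tau> f X"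
    using sampling assms by (simp_all add: stoch_subgrad_oracle_def)
qed

text \<open>
  The arithmetic-geometric mean inequality \<open>Lz z \<le> (L\<^sup>2 + (Lz z)\<^sup>2) / (2 * L)\<close> turns the second moment
  of \<open>Lz\<close>, which is \<open>L\<^sup>2\<close>, into the bound \<open>L\<close> on the mean of the norms.
\<close>

lemma norm_oracle_mean_le:
  assumes X: "X \<in> Stiefel"
  shows "norm (LINT z|D. G X z) \<le> L"
proof -
  have "norm (LINT z|D. G X z) \<le> (LINT z|D. norm (G X z))"
    by (rule integral_norm_bound)
  also have "\<dots> \<le> (LINT z|D. (L\<^sup>2 + (Lz z)\<^sup>2) / (2 * L))"
  proof (rule integral_mono)
    show "integrable D (\<lambda>z. norm (G X z))"
      using oracle_integrable[OF X] by (rule integrable_norm)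
    show "integrable D (\<lambda>z. (L\<^sup>2 + (Lz z)\<^sup>2) / (2 * L))"
      using Lz_square by simp
    fix z assume z: "z \<in> space D"
    have "0 \<le> (L - Lz z)\<^sup>2" by simp
    then have "Lz z \<le> (L\<^sup>2 + (Lz z)\<^sup>2) / (2 * L)"
      using L(1) by (simp add: field_simps power2_eq_square)
    then show "norm (G X z) \<le> (L\<^sup>2 + (Lz z)\<^sup>2) / (2 * L)"
      using norm_oracle_le[OF X z] by linarith
  qed
  also have "\<dots> = (L\<^sup>2 + L\<^sup>2) / (2 * L)"
    using Lz_square by (simp add: L(2)[symmetric] D.prob_space)
  also have "\<dots> = L"
    using L(1) by (simp add: power2_eq_square)
  finally show ?thesis .
qed

text \<open>
  The proximal point of \<open>X\<close> competes in the problem that defines the envelope at the next iterate, and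
  the retraction brings that iterate no farther from it than the unretracted step.  The remaining terms
  are the expansion of the squared distance after a Euclidean step.
\<close>

lemma moreau_env_step_le:
  assumes X: "X \<in> Stiefel" and z: "z \<in> space D"
  shows "env (step X z)
    \<le> env X + c / lam * (tangent_proj X (G X z) \<bullet> (P X - X)) + c\<^sup>2 / (2 * lam) * (Lz z)\<^sup>2"
proof -
  define \<xi> where "\<xi> = tangent_proj X (G X z)"
  have PX: "P X \<in> Stiefel" by (rule prox_in_Stiefel[OF P X])
  have "norm (P X - step X z) \<le> norm (P X - (X - c *\<^sub>R \<xi>))"
    using polar_retr_nonexpansive[OF X rssm_step_direction_tangent[OF X] PX, of c G z]
    by (simp add: rssm_step_def riem_stoch_subgrad_def \<xi>_def)
  then have "(norm (P X - step X z))\<^sup>2 \<le> (norm (P X - (X - c *\<^sub>R \<xi>)))\<^sup>2"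
    by (rule power_mono) simp
  also have "\<dots> = (norm (P X - X))\<^sup>2 + 2 * c * (\<xi> \<bullet> (P X - X)) + c\<^sup>2 * (norm \<xi>)\<^sup>2"
    using dot_norm[of "P X - X" "c *\<^sub>R \<xi>"]
    by (simp add: power_mult_distrib inner_commute algebra_simps)
  also have "(norm \<xi>)\<^sup>2 \<le> (Lz z)\<^sup>2"
    using norm_tangent_proj_le[OF X, of "G X z"] norm_oracle_le[OF X z]
    unfolding \<xi>_def by (intro power_mono) auto
  finally have dist: "(norm (P X - step X z))\<^sup>2
      \<le> (norm (P X - X))\<^sup>2 + 2 * c * (\<xi> \<bullet> (P X - X)) + c\<^sup>2 * (Lz z)\<^sup>2"
    by (simp add: mult_left_mono)
  have "env (step X z) \<le> f (P X) + 1 / (2 * lam) * (norm (P X - step X z))\<^sup>2"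
    by (rule moreau_env_le[OF P rssm_step_Stiefel[OF X] PX])
  also have "\<dots> \<le> f (P X) + 1 / (2 * lam) *
      ((norm (P X - X))\<^sup>2 + 2 * c * (\<xi> \<bullet> (P X - X)) + c\<^sup>2 * (Lz z)\<^sup>2)"
    using dist lam(1) by (intro add_left_mono mult_left_mono) auto
  also have "\<dots> = env X + c / lam * (\<xi> \<bullet> (P X - X)) + c\<^sup>2 / (2 * lam) * (Lz z)\<^sup>2"
    unfolding moreau_env_eq_prox[OF P X] using lam(1) by (simp add: field_simps)
  finally show ?thesis unfolding \<xi>_def .
qed

lemma env_lipschitz: "\<exists>K. K-lipschitz_on Stiefel env"
  using moreau_env_lipschitz[OF P lam(1)] by blast

lemma env_measurable: "env \<in> borel_measurable Stiefel_borel"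
  using env_lipschitz lipschitz_on_continuous_on
  by (blast intro: borel_measurable_continuous_on_restrict)

lemma env_bounded: "\<exists>K. \<forall>X\<in>Stiefel. \<bar>env X\<bar> \<le> K"
proof -
  have "continuous_on Stiefel env"
    using env_lipschitz lipschitz_on_continuous_on by blast
  then have "bounded (env ` Stiefel)"
    by (intro compact_imp_bounded compact_continuous_image compact_Stiefel)
  then show ?thesis
    by (auto simp: bounded_iff)
qed

lemma env_bdd_below: "bdd_below (env ` Stiefel)"
  using env_bounded by (metis abs_le_D2 bdd_belowI2 minus_le_iff)

lemma step_measurable: "(\<lambda>(X, z). step X z) \<in> Stiefel_borel \<Otimes>\<^sub>M D \<rightarrow>\<^sub>M Stiefel_borel"
  using sampling Stiefel_nonempty by (intro rssm_step_measurable) (auto simp: stoch_subgrad_oracle_def)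

lemma env_step_measurable:
  "(\<lambda>(X, z). env (step X z)) \<in> borel_measurable (Stiefel_borel \<Otimes>\<^sub>M D)"
  using measurable_compose[OF step_measurable env_measurable] by (simp add: case_prod_beta')

lemma env_step_integrable:
  assumes X: "X \<in> Stiefel"
  shows "integrable D (\<lambda>z. env (step X z))"
proof -
  obtain K where K: "\<And>X. X \<in> Stiefel \<Longrightarrow> \<bar>env X\<bar> \<le> K"
    using env_bounded by blast
  have "(\<lambda>z. env (step X z)) \<in> borel_measurable D"
    using measurable_compose[OF measurable_Pair1' env_step_measurable, of X] X
    by (simp add: space_restrict_space)
  then show ?thesis
    by (rule D.integrable_const_bound[where B = K, rotated])
      (auto intro!: AE_I2 K rssm_step_Stiefel X)
qed

definition expected_env_step :: "real^'r^'n \<Rightarrow> real" where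
  "expected_env_step X = (LINT z|D. env (step X z))"

lemma expected_env_step_measurable: "expected_env_step \<in> borel_measurable Stiefel_borel"
  unfolding expected_env_step_def
  by (rule D.borel_measurable_lebesgue_integral) (rule env_step_measurable)

text \<open>
  The right-hand side of the one-step inequality, solved for the squared stationarity measure.  Unlike
  \<open>Theta\<close> itself, which inherits the arbitrariness of \<open>P\<close>, it is a Borel function of the iterate.
\<close>

definition Theta_majorant :: "real^'r^'n \<Rightarrow> real" where
  "Theta_majorant X = (env X - expected_env_step X + c\<^sup>2 * L\<^sup>2 / (2 * lam))
     / (c * lam * (1 / lam - (L + \<tau>)) / 2)"

text \<open>
  The fresh sample enters the step bound linearly, so its mean subgradient \<open>V\<close> may be put into the
  subgradient inequality between \<open>X\<close> and its proximal point.  That point is at least as good as \<open>X\<close> in the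
  proximal problem, which makes \<open>f (P X) - f X\<close> at most \<open>- N / (2 * lam)\<close>; since \<open>1 / lam\<close> exceeds \<open>L + \<tau>\<close>, a
  positive multiple of \<open>N\<close> remains as guaranteed decrease.
\<close>

lemma Theta_square_le_majorant:
  assumes X: "X \<in> Stiefel"
  shows "(Theta lam P X)\<^sup>2 \<le> Theta_majorant X"
proof -
  define V where "V = (LINT z|D. G X z)"
  define N where "N = (norm (P X - X))\<^sup>2"
  have PX: "P X \<in> Stiefel" by (rule prox_in_Stiefel[OF P X])
  have bl: "bounded_linear (\<lambda>B. tangent_proj X B \<bullet> (P X - X))"
    using linear_tangent_proj[of X]
    by (intro bounded_linear_inner_left_comp) (simp add: linear_conv_bounded_linear)
  have int: "integrable D (\<lambda>z. tangent_proj X (G X z) \<bullet> (P X - X))"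
    and mean: "(LINT z|D. tangent_proj X (G X z) \<bullet> (P X - X)) = tangent_proj X V \<bullet> (P X - X)"
    unfolding V_def using integrable_bounded_linear[OF bl] integral_bounded_linear[OF bl]
      oracle_integrable[OF X] by auto
  have "expected_env_step X \<le> (LINT z|D. env X + c / lam * (tangent_proj X (G X z) \<bullet> (P X - X))
      + c\<^sup>2 / (2 * lam) * (Lz z)\<^sup>2)"
    unfolding expected_env_step_def
    using env_step_integrable[OF X] int Lz_square moreau_env_step_le[OF X]
    by (intro integral_mono) auto
  also have "\<dots> = env X + c / lam * (tangent_proj X V \<bullet> (P X - X)) + c\<^sup>2 / (2 * lam) * L\<^sup>2"
    using int Lz_square by (simp add: mean L(2)[symmetric] D.prob_space)
  also have "\<dots> \<le> env X + c / lam * (f (P X) - f X + (L + \<tau>) / 2 * N) + c\<^sup>2 / (2 * lam) * L\<^sup>2"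
    using riemannian_subgradient_inequality[OF X PX oracle_mean_subdiff[OF X, folded V_def]
        norm_oracle_mean_le[OF X, folded V_def]] lam(1) c_pos
    unfolding N_def by (intro add_mono mult_left_mono order_refl) auto
  also have "\<dots> \<le> env X + c / lam * (- (1 / (2 * lam) * N) + (L + \<tau>) / 2 * N)
      + c\<^sup>2 / (2 * lam) * L\<^sup>2"
  proof -
    have "f (P X) - f X \<le> - (1 / (2 * lam) * N)"
      using moreau_env_le[OF P X X] moreau_env_eq_prox[OF P X] by (simp add: N_def)
    then show ?thesis
      using lam(1) c_pos by (intro add_mono mult_left_mono order_refl) auto
  qed
  finally have "c / lam * ((1 / lam - (L + \<tau>)) / 2 * N)
      \<le> env X - expected_env_step X + c\<^sup>2 * L\<^sup>2 / (2 * lam)"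
    by (simp add: algebra_simps diff_divide_distrib add_divide_distrib)
  moreover have "(Theta lam P X)\<^sup>2 = N / lam\<^sup>2"
    by (simp add: Theta_def N_def power_divide)
  then have "(Theta lam P X)\<^sup>2 * (c * lam * (1 / lam - (L + \<tau>)) / 2)
      = c / lam * ((1 / lam - (L + \<tau>)) / 2 * N)"
    using lam(1) by (simp add: power2_eq_square)
  ultimately show ?thesis
    unfolding Theta_majorant_def using curvature_gap c_pos lam(1)
    by (subst pos_le_divide_eq) auto
qed

lemma Theta_majorant_measurable: "Theta_majorant \<in> borel_measurable Stiefel_borel"
  unfolding Theta_majorant_def
  using env_measurable expected_env_step_measurable by measurable

lemma Theta_majorant_nonneg: "X \<in> Stiefel \<Longrightarrow> Theta_majorant X \<ge> 0"
  using Theta_square_le_majorant[of X] zero_le_power2[of "Theta lam P X"] by linarith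

end

section \<open>Independent random variables with values in different spaces\<close>

text \<open>
  Independence is expressed by the generated \<open>\<sigma>\<close>-algebras, so that \<open>X\<close> and \<open>Y\<close> may take values in
  different types; a random index and a sample path are such a pair.
\<close>

lemma (in prob_space) distr_pair_indep_set:
  assumes X: "X \<in> measurable M S" and Y: "Y \<in> measurable M N"
    and indep: "indep_set (sets (vimage_algebra (space M) X S)) (sets (vimage_algebra (space M) Y N))"
  shows "distr M (S \<Otimes>\<^sub>M N) (\<lambda>\<omega>. (X \<omega>, Y \<omega>)) = distr M S X \<Otimes>\<^sub>M distr M N Y"
proof -
  interpret X: prob_space "distr M S X" by (rule prob_space_distr[OF X])
  interpret Y: prob_space "distr M N Y" by (rule prob_space_distr[OF Y])
  have "distr M S X \<Otimes>\<^sub>M distr M N Y = distr M (S \<Otimes>\<^sub>M N) (\<lambda>\<omega>. (X \<omega>, Y \<omega>))"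
  proof (rule pair_measure_eqI)
    show "sets (distr M S X \<Otimes>\<^sub>M distr M N Y) = sets (distr M (S \<Otimes>\<^sub>M N) (\<lambda>\<omega>. (X \<omega>, Y \<omega>)))"
      by (simp cong: sets_pair_measure_cong)
    fix A C assume "A \<in> sets (distr M S X)" "C \<in> sets (distr M N Y)"
    then have A: "A \<in> sets S" and C: "C \<in> sets N" by auto
    have "prob ((X -` A \<inter> space M) \<inter> (Y -` C \<inter> space M))
        = prob (X -` A \<inter> space M) * prob (Y -` C \<inter> space M)"
      by (rule indep_setD[OF indep in_vimage_algebra[OF A] in_vimage_algebra[OF C]])
    moreover have "(X -` A \<inter> space M) \<inter> (Y -` C \<inter> space M)
        = (\<lambda>\<omega>. (X \<omega>, Y \<omega>)) -` (A \<times> C) \<inter> space M"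
      by auto
    ultimately show "emeasure (distr M S X) A * emeasure (distr M N Y) C
        = emeasure (distr M (S \<Otimes>\<^sub>M N) (\<lambda>\<omega>. (X \<omega>, Y \<omega>))) (A \<times> C)"
      using X Y A C
      by (simp add: emeasure_distr emeasure_eq_measure ennreal_mult)
  qed (unfold_locales)
  then show ?thesis ..
qed

text \<open>
  The expectation is computed by freezing \<open>X\<close> and averaging over an independent copy of \<open>Y\<close>.
\<close>

lemma (in prob_space) indep_set_integral_pair:
  fixes \<phi> :: "'b \<times> 'c \<Rightarrow> real"
  assumes X: "X \<in> measurable M S" and Y: "Y \<in> measurable M N"
    and indep: "indep_set (sets (vimage_algebra (space M) X S)) (sets (vimage_algebra (space M) Y N))"
    and \<phi>: "\<phi> \<in> borel_measurable (S \<Otimes>\<^sub>M N)"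
    and bound: "\<And>p. p \<in> space (S \<Otimes>\<^sub>M N) \<Longrightarrow> \<bar>\<phi> p\<bar> \<le> K"
  shows "(LINT \<omega>|M. \<phi> (X \<omega>, Y \<omega>)) = (LINT \<omega>|M. LINT \<omega>'|M. \<phi> (X \<omega>, Y \<omega>'))"
proof -
  interpret X: prob_space "distr M S X" by (rule prob_space_distr[OF X])
  interpret Y: prob_space "distr M N Y" by (rule prob_space_distr[OF Y])
  interpret XY: pair_prob_space "distr M S X" "distr M N Y" ..
  have sets_eq: "sets (distr M S X \<Otimes>\<^sub>M distr M N Y) = sets (S \<Otimes>\<^sub>M N)"
    by (intro sets_pair_measure_cong) auto
  have sec: "\<phi> \<in> borel_measurable (S \<Otimes>\<^sub>M distr M N Y)"
    using \<phi> measurable_cong_sets[OF sets_pair_measure_cong[OF refl sets_distr] refl] by blast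
  have int: "integrable (distr M S X \<Otimes>\<^sub>M distr M N Y) \<phi>"
  proof (rule XY.P.integrable_const_bound[where B = K])
    show "AE p in distr M S X \<Otimes>\<^sub>M distr M N Y. norm (\<phi> p) \<le> K"
      using bound by (intro AE_I2) (simp add: space_pair_measure)
    show "\<phi> \<in> borel_measurable (distr M S X \<Otimes>\<^sub>M distr M N Y)"
      using \<phi> measurable_cong_sets[OF sets_eq refl] by blast
  qed
  have "(LINT \<omega>|M. \<phi> (X \<omega>, Y \<omega>)) = integral\<^sup>L (distr M (S \<Otimes>\<^sub>M N) (\<lambda>\<omega>. (X \<omega>, Y \<omega>))) \<phi>"
    using X Y \<phi> by (subst integral_distr) auto
  also have "\<dots> = (LINT x|distr M S X. LINT y|distr M N Y. \<phi> (x, y))"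
    unfolding distr_pair_indep_set[OF X Y indep] using XY.integral_fst'[OF int] by simp
  also have "\<dots> = (LINT \<omega>|M. LINT y|distr M N Y. \<phi> (X \<omega>, y))"
    by (intro integral_distr X Y.borel_measurable_lebesgue_integral) (simp add: case_prod_eta sec)
  also have "\<dots> = (LINT \<omega>|M. LINT \<omega>'|M. \<phi> (X \<omega>, Y \<omega>'))"
  proof (intro Bochner_Integration.integral_cong refl)
    fix \<omega> assume "\<omega> \<in> space M"
    then have "X \<omega> \<in> space S" using X by (rule measurable_space[rotated])
    then have "(\<lambda>y. \<phi> (X \<omega>, y)) \<in> borel_measurable N"
      using \<phi> by (rule measurable_compose[OF measurable_Pair1'])
    then show "(LINT y|distr M N Y. \<phi> (X \<omega>, y)) = (LINT \<omega>'|M. \<phi> (X \<omega>, Y \<omega>'))"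
      using Y by (intro integral_distr)
  qed
  finally show ?thesis .
qed

section \<open>The iterates of the method\<close>

lemma rssm_iterate_Suc:
  "rssm_iterate G \<gamma> X0 zs (Suc k) = rssm_step G (\<gamma> k) (rssm_iterate G \<gamma> X0 zs k) (zs k)"
  by (simp add: rssm_step_def)

lemma rssm_iterate_cong:
  "(\<And>i. i < k \<Longrightarrow> zs i = zs' i) \<Longrightarrow> rssm_iterate G \<gamma> X0 zs k = rssm_iterate G \<gamma> X0 zs' k"
  by (induction k) auto

locale stochastic_subgradient_run =
  stochastic_subgradient_problem D g f \<tau> L lam c U Lz G P + M: prob_space M
  for D :: "'z measure"
    and g :: "real^'r^'n \<Rightarrow> 'z \<Rightarrow> real"
    and f \<tau> L lam c U Lz G P
    and M :: "'w measure" +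
  fixes \<zeta> :: "nat \<Rightarrow> 'w \<Rightarrow> 'z"
    and X0 :: "real^'r^'n"
  assumes \<zeta>_measurable: "\<And>k. \<zeta> k \<in> measurable M D"
    and \<zeta>_distr: "\<And>k. distr M D (\<zeta> k) = D"
    and \<zeta>_indep: "M.indep_vars (\<lambda>_. D) \<zeta> UNIV"
    and X0: "X0 \<in> Stiefel"
begin

abbreviation iterate :: "(nat \<Rightarrow> 'z) \<Rightarrow> nat \<Rightarrow> real^'r^'n" where
  "iterate \<equiv> rssm_iterate G (\<lambda>_. c) X0"

abbreviation X :: "nat \<Rightarrow> 'w \<Rightarrow> real^'r^'n" where
  "X k \<omega> \<equiv> iterate (\<lambda>i. \<zeta> i \<omega>) k"

lemma iterate_Stiefel: "iterate zs k \<in> Stiefel"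
  by (induction k) (auto simp: X0 rssm_iterate_Suc rssm_step_Stiefel simp del: rssm_iterate.simps(2))

text \<open>
  The index set is left open because both the whole sample path and its first \<open>k\<close> entries, which are
  independent of the next sample, are needed as the source of randomness.
\<close>

lemma iterate_measurable:
  assumes "{..<k} \<subseteq> I"
  shows "(\<lambda>zs. iterate zs k) \<in> PiM I (\<lambda>_. D) \<rightarrow>\<^sub>M Stiefel_borel"
  using assms
proof (induction k)
  case 0
  then show ?case using X0 by (simp add: space_restrict_space)
next
  case (Suc k)
  then have "(\<lambda>zs. iterate zs k) \<in> PiM I (\<lambda>_. D) \<rightarrow>\<^sub>M Stiefel_borel" and "k \<in> I"
    by (auto simp: subset_iff)
  then have "(\<lambda>zs. (iterate zs k, zs k)) \<in> PiM I (\<lambda>_. D) \<rightarrow>\<^sub>M Stiefel_borel \<Otimes>\<^sub>M D"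
    by (intro measurable_Pair measurable_component_singleton)
  from measurable_compose[OF this step_measurable] show ?case
    by (simp add: rssm_iterate_Suc del: rssm_iterate.simps(2))
qed

lemma \<zeta>_path_measurable: "(\<lambda>\<omega> i. \<zeta> i \<omega>) \<in> M \<rightarrow>\<^sub>M PiM UNIV (\<lambda>_. D)"
  using measurable_restrict[of UNIV \<zeta> M "\<lambda>_. D"] \<zeta>_measurable by (simp add: restrict_def)

lemma X_measurable: "X k \<in> M \<rightarrow>\<^sub>M Stiefel_borel"
  using measurable_compose[OF \<zeta>_path_measurable iterate_measurable[of k UNIV]] by simp

lemma integrable_env_X: "integrable M (\<lambda>\<omega>. env (X k \<omega>))"
proof -
  obtain K where "\<And>X. X \<in> Stiefel \<Longrightarrow> \<bar>env X\<bar> \<le> K" using env_bounded by blast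
  then show ?thesis
    using measurable_compose[OF X_measurable env_measurable]
    by (intro M.integrable_const_bound[where B = K]) (auto intro!: AE_I2 iterate_Stiefel)
qed

lemma integrable_expected_env_step_X: "integrable M (\<lambda>\<omega>. expected_env_step (X k \<omega>))"
proof -
  obtain K where K: "\<And>X. X \<in> Stiefel \<Longrightarrow> \<bar>env X\<bar> \<le> K" using env_bounded by blast
  have "\<bar>expected_env_step Y\<bar> \<le> K" if Y: "Y \<in> Stiefel" for Y
  proof -
    have "norm (LINT z|D. env (step Y z)) \<le> (LINT z|D. norm (env (step Y z)))"
      by (rule integral_norm_bound)
    also have "\<dots> \<le> (LINT z|D. K)"
      using env_step_integrable[OF Y] K[OF rssm_step_Stiefel[OF Y]]
      by (intro integral_mono) auto
    finally show ?thesis by (simp add: expected_env_step_def D.prob_space)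
  qed
  then show ?thesis
    using measurable_compose[OF X_measurable expected_env_step_measurable]
    by (intro M.integrable_const_bound[where B = K]) (auto intro!: AE_I2 iterate_Stiefel)
qed

text \<open>
  The \<open>k\<close>-th iterate depends on earlier samples only; given these, the next sample still has law \<open>D\<close>.
\<close>

lemma expectation_env_X_Suc:
  "M.expectation (\<lambda>\<omega>. env (X (Suc k) \<omega>)) = M.expectation (\<lambda>\<omega>. expected_env_step (X k \<omega>))"
proof -
  obtain K where K: "\<And>X. X \<in> Stiefel \<Longrightarrow> \<bar>env X\<bar> \<le> K" using env_bounded by blast
  \<comment> \<open>The split of the sample path separates what determines the current iterate from the fresh
    sample.\<close>
  let ?past = "PiM {..<k} (\<lambda>_. D)" and ?fresh = "PiM {k} (\<lambda>_. D)"
  let ?\<phi> = "\<lambda>p. env (step (iterate (fst p) k) (snd p k))"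
  have "M.indep_var ?past (\<lambda>\<omega>. restrict (\<lambda>i. \<zeta> i \<omega>) {..<k}) ?fresh (\<lambda>\<omega>. restrict (\<lambda>i. \<zeta> i \<omega>) {k})"
    by (rule M.indep_var_restrict[OF \<zeta>_indep]) auto
  then have rv: "(\<lambda>\<omega>. restrict (\<lambda>i. \<zeta> i \<omega>) {..<k}) \<in> M \<rightarrow>\<^sub>M ?past"
      "(\<lambda>\<omega>. restrict (\<lambda>i. \<zeta> i \<omega>) {k}) \<in> M \<rightarrow>\<^sub>M ?fresh"
    and indep: "M.indep_set (sets (vimage_algebra (space M) (\<lambda>\<omega>. restrict (\<lambda>i. \<zeta> i \<omega>) {..<k}) ?past))
      (sets (vimage_algebra (space M) (\<lambda>\<omega>. restrict (\<lambda>i. \<zeta> i \<omega>) {k}) ?fresh))"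
    unfolding M.indep_var_eq sets_vimage_algebra by auto
  have "(\<lambda>p. (iterate (fst p) k, snd p k)) \<in> ?past \<Otimes>\<^sub>M ?fresh \<rightarrow>\<^sub>M Stiefel_borel \<Otimes>\<^sub>M D"
    by (intro measurable_Pair measurable_compose[OF measurable_fst iterate_measurable]
        measurable_compose[OF measurable_snd measurable_component_singleton]) auto
  from measurable_compose[OF this env_step_measurable]
  have \<phi>: "?\<phi> \<in> borel_measurable (?past \<Otimes>\<^sub>M ?fresh)" by simp
  have past: "iterate (restrict (\<lambda>i. \<zeta> i \<omega>) {..<k}) k = X k \<omega>" for \<omega>
    by (rule rssm_iterate_cong) simp
  have "(LINT \<omega>|M. env (step (X k \<omega>) (\<zeta> k \<omega>))) = (LINT \<omega>|M. LINT \<omega>'|M. env (step (X k \<omega>) (\<zeta> k \<omega>')))"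
    using M.indep_set_integral_pair[OF rv indep \<phi>, of K]
    by (simp add: past K rssm_step_Stiefel iterate_Stiefel)
  also have "\<dots> = (LINT \<omega>|M. expected_env_step (X k \<omega>))"
  proof (intro Bochner_Integration.integral_cong refl)
    fix \<omega>
    have "(LINT \<omega>'|M. env (step (X k \<omega>) (\<zeta> k \<omega>'))) = (LINT z|distr M D (\<zeta> k). env (step (X k \<omega>) z))"
      using env_step_integrable[OF iterate_Stiefel]
      by (intro integral_distr[symmetric] \<zeta>_measurable) (simp add: integrable_iff_bounded)
    then show "(LINT \<omega>'|M. env (step (X k \<omega>) (\<zeta> k \<omega>'))) = expected_env_step (X k \<omega>)"
      by (simp add: \<zeta>_distr expected_env_step_def)
  qed
  finally show ?thesis
    by (simp add: rssm_iterate_Suc del: rssm_iterate.simps(2))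
qed

lemma integrable_Theta_majorant_X: "integrable M (\<lambda>\<omega>. Theta_majorant (X k \<omega>))"
  unfolding Theta_majorant_def
  using integrable_env_X[of k] integrable_expected_env_step_X[of k] by simp

text \<open>
  The expected decreases of the envelope telescope, and the envelope never falls below its infimum.
\<close>

lemma sum_expectation_Theta_majorant_le:
  "(\<Sum>k\<le>T. M.expectation (\<lambda>\<omega>. Theta_majorant (X k \<omega>)))
    \<le> (env X0 - (INF Y\<in>Stiefel. env Y) + real (T + 1) * (c\<^sup>2 * L\<^sup>2 / (2 * lam)))
       / (c * lam * (1 / lam - (L + \<tau>)) / 2)"
proof -
  define d where "d = c * lam * (1 / lam - (L + \<tau>)) / 2"
  define b where "b = c\<^sup>2 * L\<^sup>2 / (2 * lam)"
  define e where "e k = M.expectation (\<lambda>\<omega>. env (X k \<omega>))" for k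
  have d: "d > 0" using curvature_gap c_pos lam(1) by (simp add: d_def)
  have majorant_mean: "M.expectation (\<lambda>\<omega>. Theta_majorant (X k \<omega>)) = (e k - e (Suc k) + b) / d" for k
    unfolding Theta_majorant_def d_def[symmetric] b_def[symmetric]
    using integrable_env_X[of k] integrable_expected_env_step_X[of k]
    by (simp add: e_def expectation_env_X_Suc M.prob_space del: rssm_iterate.simps(2))
  have inf: "(INF Y\<in>Stiefel. env Y) \<le> e (Suc T)"
  proof -
    have "(INF Y\<in>Stiefel. env Y) \<le> env (X (Suc T) \<omega>)" for \<omega>
      by (intro cINF_lower env_bdd_below iterate_Stiefel)
    then have "(LINT \<omega>|M. (INF Y\<in>Stiefel. env Y)) \<le> e (Suc T)"
      unfolding e_def by (intro integral_mono integrable_env_X) auto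
    then show ?thesis by (simp add: M.prob_space)
  qed
  have "(\<Sum>k\<le>T. M.expectation (\<lambda>\<omega>. Theta_majorant (X k \<omega>))) = (\<Sum>k\<le>T. e k - e (Suc k) + b) / d"
    unfolding majorant_mean by (rule sum_divide_distrib[symmetric])
  also have "(\<Sum>k\<le>T. e k - e (Suc k) + b) = e 0 - e (Suc T) + real (T + 1) * b"
    by (simp add: sum.distrib sum_telescope)
  also have "e 0 = env X0" by (simp add: e_def M.prob_space)
  also have "(env X0 - e (Suc T) + real (T + 1) * b) / d
      \<le> (env X0 - (INF Y\<in>Stiefel. env Y) + real (T + 1) * b) / d"
    using inf d by (intro divide_right_mono) auto
  finally show ?thesis
    unfolding d_def b_def .
qed

text \<open>
  The random index is independent of the whole sample path, so the expectation is the average over the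
  index of the expectations at fixed times.
\<close>

lemma nn_integral_random_index:
  fixes H :: "real^'r^'n \<Rightarrow> ennreal"
  assumes kbar: "kbar \<in> measurable M (count_space UNIV)"
    and uniform: "distr M (count_space UNIV) kbar = measure_pmf (pmf_of_set {0..T})"
    and indep: "M.indep_set (sets (vimage_algebra (space M) kbar (count_space UNIV)))
           (sets (vimage_algebra (space M) (\<lambda>\<omega> i. \<zeta> i \<omega>) (PiM UNIV (\<lambda>_. D))))"
    and H: "H \<in> borel_measurable Stiefel_borel"
  shows "(\<integral>\<^sup>+\<omega>. H (X (kbar \<omega>) \<omega>) \<partial>M) = (\<Sum>k\<le>T. \<integral>\<^sup>+\<omega>. H (X k \<omega>) \<partial>M) / of_nat (T + 1)"
proof -
  let ?C = "count_space (UNIV :: nat set)" and ?S = "PiM UNIV (\<lambda>_ :: nat. D)"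
  let ?z = "\<lambda>\<omega> i. \<zeta> i \<omega>"
  let ?F = "\<lambda>p. H (iterate (snd p) (fst p))"
  have joint: "distr M (?C \<Otimes>\<^sub>M ?S) (\<lambda>\<omega>. (kbar \<omega>, ?z \<omega>)) = distr M ?C kbar \<Otimes>\<^sub>M distr M ?S ?z"
    by (rule M.distr_pair_indep_set[OF kbar \<zeta>_path_measurable indep])
  have sec: "(\<lambda>s. H (iterate s k)) \<in> borel_measurable ?S" for k
    by (rule measurable_compose[OF iterate_measurable H]) simp
  then have F: "?F \<in> borel_measurable (?C \<Otimes>\<^sub>M ?S)"
    by (intro measurable_pair_measure_countable1) auto
  interpret S: prob_space "distr M ?S ?z"
    by (rule M.prob_space_distr[OF \<zeta>_path_measurable])
  have sets_eq: "sets (distr M ?C kbar \<Otimes>\<^sub>M distr M ?S ?z) = sets (?C \<Otimes>\<^sub>M ?S)"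
    by (intro sets_pair_measure_cong) auto
  have "(\<integral>\<^sup>+\<omega>. H (X (kbar \<omega>) \<omega>) \<partial>M) = (\<integral>\<^sup>+p. ?F p \<partial>distr M (?C \<Otimes>\<^sub>M ?S) (\<lambda>\<omega>. (kbar \<omega>, ?z \<omega>)))"
    using kbar \<zeta>_path_measurable F by (subst nn_integral_distr) auto
  also have "\<dots> = (\<integral>\<^sup>+k. \<integral>\<^sup>+s. ?F (k, s) \<partial>distr M ?S ?z \<partial>distr M ?C kbar)"
    unfolding joint
    by (rule S.nn_integral_fst[symmetric]) (use F measurable_cong_sets[OF sets_eq refl] in blast)
  also have "\<dots> = (\<integral>\<^sup>+k. \<integral>\<^sup>+\<omega>. H (X k \<omega>) \<partial>M \<partial>measure_pmf (pmf_of_set {0..T}))"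
    unfolding uniform using sec \<zeta>_path_measurable
    by (intro nn_integral_cong) (simp add: nn_integral_distr)
  also have "\<dots> = (\<Sum>k\<in>{0..T}. \<integral>\<^sup>+\<omega>. H (X k \<omega>) \<partial>M) / of_nat (T + 1)"
    by (subst nn_integral_pmf_of_set) auto
  finally show ?thesis by (simp add: atMost_atLeast0)
qed

text \<open>
  With \<open>c = 1 / sqrt (T + 1)\<close> the accumulated second-order terms add up to the constant \<open>L\<^sup>2 / (2 * lam)\<close>,
  while division by \<open>c * (T + 1)\<close> produces the rate \<open>1 / sqrt (T + 1)\<close>.
\<close>

lemma nn_integral_Theta_majorant_random_index_le:
  assumes kbar: "kbar \<in> measurable M (count_space UNIV)"
    and uniform: "distr M (count_space UNIV) kbar = measure_pmf (pmf_of_set {0..T})"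
    and indep: "M.indep_set (sets (vimage_algebra (space M) kbar (count_space UNIV)))
           (sets (vimage_algebra (space M) (\<lambda>\<omega> i. \<zeta> i \<omega>) (PiM UNIV (\<lambda>_. D))))"
    and c: "c = 1 / sqrt (real T + 1)"
  shows "(\<integral>\<^sup>+\<omega>. ennreal (Theta_majorant (X (kbar \<omega>) \<omega>)) \<partial>M)
    \<le> ennreal (1 / (lam * (1 / lam - (L + \<tau>))) *
             ((2 * (env X0 - (INF Y\<in>Stiefel. env Y)) + L\<^sup>2 / lam) / sqrt (real T + 1)))"
proof -
  define q where "q = sqrt (real T + 1)"
  have q: "q > 0" "q\<^sup>2 = real T + 1" by (simp_all add: q_def)
  define d where "d = lam * (1 / lam - (L + \<tau>))"
  have d: "d > 0" using curvature_gap lam(1) by (simp add: d_def)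
  define gap where "gap = env X0 - (INF Y\<in>Stiefel. env Y)"
  let ?m = "\<lambda>k. M.expectation (\<lambda>\<omega>. Theta_majorant (X k \<omega>))"
  have nn: "(\<integral>\<^sup>+\<omega>. ennreal (Theta_majorant (X k \<omega>)) \<partial>M) = ennreal (?m k)" for k
    by (intro nn_integral_eq_integral integrable_Theta_majorant_X AE_I2 Theta_majorant_nonneg iterate_Stiefel)
  have m: "?m k \<ge> 0" for k
    by (intro integral_nonneg_AE AE_I2 Theta_majorant_nonneg iterate_Stiefel)
  have "(\<integral>\<^sup>+\<omega>. ennreal (Theta_majorant (X (kbar \<omega>) \<omega>)) \<partial>M) = (\<Sum>k\<le>T. ennreal (?m k)) / of_nat (T + 1)"
    using nn_integral_random_index[OF kbar uniform indep, of "\<lambda>Y. ennreal (Theta_majorant Y)"]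
      Theta_majorant_measurable by (simp add: nn)
  also have "\<dots> = ennreal ((\<Sum>k\<le>T. ?m k) / real (T + 1))"
    using m by (simp add: sum_ennreal sum_nonneg ennreal_of_nat_eq_real_of_nat divide_ennreal del: of_nat_Suc of_nat_add)
  also have "\<dots> \<le> ennreal (1 / d * ((2 * gap + L\<^sup>2 / lam) / q))"
  proof (rule ennreal_leI)
    have "(\<Sum>k\<le>T. ?m k) / real (T + 1)
        \<le> ((gap + real (T + 1) * (c\<^sup>2 * L\<^sup>2 / (2 * lam))) / (c * d / 2)) / real (T + 1)"
      using sum_expectation_Theta_majorant_le[of T]
      unfolding d_def gap_def by (intro divide_right_mono) (simp_all add: mult.assoc)
    also have "\<dots> = 1 / d * ((2 * gap + L\<^sup>2 / lam) / q)"
    proof -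
      have "c = 1 / q" and "real (T + 1) = q\<^sup>2"
        using q by (simp_all add: c q_def)
      then show ?thesis
        using q(1) d lam(1) by (simp only:) (simp add: field_simps power2_eq_square)
    qed
    finally show "(\<Sum>k\<le>T. ?m k) / real (T + 1) \<le> 1 / d * ((2 * gap + L\<^sup>2 / lam) / q)" .
  qed
  finally show ?thesis unfolding d_def gap_def q_def .
qed

end

section \<open>The convergence rate\<close>

lemma upper_nn_integral_le:
  assumes "h \<in> borel_measurable M" "\<And>\<omega>. \<omega> \<in> space M \<Longrightarrow> F \<omega> \<le> h \<omega>"
  shows "upper_nn_integral M F \<le> (\<integral>\<^sup>+\<omega>. h \<omega> \<partial>M)"
  unfolding upper_nn_integral_def using assms by (intro INF_lower) auto

lemma expectation_le_of_upper_nn_integral_le: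
  fixes h :: "'w \<Rightarrow> real"
  assumes h: "h \<in> borel_measurable M" "\<And>\<omega>. h \<omega> \<ge> 0" and B: "B \<ge> 0"
    and le: "upper_nn_integral M (\<lambda>\<omega>. ennreal (h \<omega>)) \<le> ennreal B"
  shows "integrable M h \<and> integral\<^sup>L M h \<le> B"
proof -
  have le': "(\<integral>\<^sup>+\<omega>. ennreal (h \<omega>) \<partial>M) \<le> ennreal B"
    using le h by (subst (asm) upper_nn_integral_measurable) auto
  have "integrable M h"
    using h le' by (intro integrableI_nonneg) (auto simp: top_unique less_top[symmetric])
  moreover from this have "ennreal (integral\<^sup>L M h) \<le> ennreal B"
    using le' h by (simp add: nn_integral_eq_integral)
  ultimately show ?thesis
    using B by (simp add: ennreal_le_iff)
qed

theorem theorem3: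
  fixes D :: "'z measure"
    and g :: "real^'r^'n \<Rightarrow> 'z \<Rightarrow> real"
    and f :: "real^'r^'n \<Rightarrow> real"
    and \<tau> L lam :: real
    and U :: "(real^'r^'n) set"
    and Lz :: "'z \<Rightarrow> real"
    and G :: "real^'r^'n \<Rightarrow> 'z \<Rightarrow> real^'r^'n"
    and M :: "'w measure"
    and \<zeta> :: "nat \<Rightarrow> 'w \<Rightarrow> 'z"
    and \<gamma> :: "nat \<Rightarrow> real"
    and X0 :: "real^'r^'n"
    and X :: "nat \<Rightarrow> 'w \<Rightarrow> real^'r^'n"
    and T :: nat
    and kbar :: "'w \<Rightarrow> nat"
    and P :: "real^'r^'n \<Rightarrow> real^'r^'n"
    and B :: real
  assumes "prob_space D"
    and "\<tau> \<ge> 0"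
    and "\<And>z. z \<in> space D \<Longrightarrow> weakly_convex \<tau> (\<lambda>Y. g Y z)"
    and "\<And>Y. integrable D (g Y)"
    and "\<And>Y. f Y = (LINT z|D. g Y z)"
    and "open U" and "bounded U" and "convex U" and "Stiefel \<subseteq> U"
    and "\<And>z. z \<in> space D \<Longrightarrow> Lz z > 0"
    and "\<And>z. z \<in> space D \<Longrightarrow> (Lz z)-lipschitz_on U (\<lambda>Y. g Y z)"
    and "integrable D (\<lambda>z. (Lz z)\<^sup>2)"
    and "L > 0" and "L\<^sup>2 = (LINT z|D. (Lz z)\<^sup>2)"
    and "stoch_subgrad_oracle D \<tau> g G"
    and "prob_space M"
    and "\<And>k. \<zeta> k \<in> measurable M D"
    and "\<And>k. distr M D (\<zeta> k) = D"
    and "prob_space.indep_vars M (\<lambda>_. D) \<zeta> UNIV"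
    and "X0 \<in> Stiefel"
    and "\<And>k. \<gamma> k = 1 / sqrt (real T + 1)"
    and "\<And>k \<omega>. X k \<omega> = rssm_iterate G \<gamma> X0 (\<lambda>i. \<zeta> i \<omega>) k"
    and "kbar \<in> measurable M (count_space UNIV)"
    and "distr M (count_space UNIV) kbar = measure_pmf (pmf_of_set {0..T})"
    and "prob_space.indep_set M
           (sets (vimage_algebra (space M) kbar (count_space UNIV)))
           (sets (vimage_algebra (space M) (\<lambda>\<omega> i. \<zeta> i \<omega>) (PiM UNIV (\<lambda>_. D))))"
    and "0 < lam" and "lam < 1 / (L + \<tau>)"
    and "is_prox_selection lam f P"
    and "B = 1 / (lam * (1 / lam - (L + \<tau>))) *
             ((2 * (moreau_env lam f X0 - (INF Y\<in>Stiefel. moreau_env lam f Y)) + L\<^sup>2 / lam)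
               / sqrt (real T + 1))"
  shows "upper_nn_integral M (\<lambda>\<omega>. ennreal ((Theta lam P (X (kbar \<omega>) \<omega>))\<^sup>2)) \<le> ennreal B
       \<and> ((\<lambda>\<omega>. (Theta lam P (X (kbar \<omega>) \<omega>))\<^sup>2) \<in> borel_measurable M \<longrightarrow>
            integrable M (\<lambda>\<omega>. (Theta lam P (X (kbar \<omega>) \<omega>))\<^sup>2) \<and>
            prob_space.expectation M (\<lambda>\<omega>. (Theta lam P (X (kbar \<omega>) \<omega>))\<^sup>2) \<le> B)"
proof -
  define c where "c = 1 / sqrt (real T + 1)"
  have \<gamma>: "\<gamma> = (\<lambda>_. c)" using assms(21) by (simp add: c_def fun_eq_iff)
  have c: "c > 0" by (simp add: c_def)
  interpret D: prob_space D by (rule assms(1))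
  interpret M: prob_space M by (rule assms(16))
  interpret stochastic_subgradient_run D g f \<tau> L lam c U Lz G P M \<zeta> X0
    by unfold_locales (use assms c in \<open>auto\<close>)
  have X: "X k \<omega> = rssm_iterate G (\<lambda>_. c) X0 (\<lambda>i. \<zeta> i \<omega>) k" for k \<omega>
    using assms(22) by (simp add: \<gamma>)
  \<comment> \<open>The measurable function that witnesses the bound on the upper integral.\<close>
  let ?h = "\<lambda>\<omega>. ennreal (Theta_majorant (X (kbar \<omega>) \<omega>))"
  have upper: "upper_nn_integral M (\<lambda>\<omega>. ennreal ((Theta lam P (X (kbar \<omega>) \<omega>))\<^sup>2)) \<le> ennreal B"
  proof (rule order_trans[OF upper_nn_integral_le])
    have "(\<lambda>\<omega>. Theta_majorant (X (kbar \<omega>) \<omega>)) \<in> borel_measurable M"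
      unfolding X
      by (rule measurable_compose_countable[OF measurable_compose[OF X_measurable Theta_majorant_measurable]])
        (rule assms(23))
    then show "?h \<in> borel_measurable M" by simp
    show "ennreal ((Theta lam P (X (kbar \<omega>) \<omega>))\<^sup>2) \<le> ?h \<omega>" for \<omega>
      unfolding X by (intro ennreal_leI Theta_square_le_majorant iterate_Stiefel)
    show "(\<integral>\<^sup>+\<omega>. ?h \<omega> \<partial>M) \<le> ennreal B"
      unfolding X assms(29)
      by (rule nn_integral_Theta_majorant_random_index_le[OF assms(23,24,25) c_def])
  qed
  moreover have "B \<ge> 0"
  proof -
    have "(INF Y\<in>Stiefel. moreau_env lam f Y) \<le> moreau_env lam f X0"
      by (rule cINF_lower[OF env_bdd_below assms(20)])
    then show ?thesis
      unfolding assms(29) using curvature_gap assms(26) by simp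
  qed
  ultimately show ?thesis
    using expectation_le_of_upper_nn_integral_le[of "\<lambda>\<omega>. (Theta lam P (X (kbar \<omega>) \<omega>))\<^sup>2" M B] by simp
qed

end
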